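(* Let $\lambda<0$, let $n\ge3$ be an integer, let $R>0$, and suppose $v_0(R)<0$. Then there exists $t_c\in(0,\infty)$ such that $X(t_c,R)=0$ or $\Gamma(t_c,R)=0$ if and only if $A(R)=0$ or one of the following five conditions holds: (1) $\partial_rC(R)<0$; (2) $\partial_rC(R)=0$ and $$\frac1{|v_0(R)|}-\frac12\int_R^\infty\frac{\partial_rA(R)y^{-(n-2)}}{(C(R)-A(R)y^{-(n-2)})^{3/2}}dy<2\partial_rt_*(R);$$ (3) $0<\partial_rC(R)\le\partial_rA(R)R^{-(n-2)}$ and $$\frac1{|v_0(R)|}+\frac12\int_R^{\left(\frac{\partial_rA(R)}{\partial_rC(R)}\right)^{\frac1{n-2}}}\frac{\partial_rC(R)-\partial_rA(R)y^{-(n-2)}}{(C(R)-A(R)y^{-(n-2)})^{3/2}}dy\le2\partial_rt_*(R);$$ (4) $\partial_rA(R)R^{-(n-2)}<\partial_rC(R)<\partial_rA(R)\big(R^{-(n-2)}+v_0(R)^2/A(R)\big)$ and $$\frac1{|v_0(R)|}+\frac12\int_R^{\left(\frac{\partial_rA(R)}{\partial_rC(R)}\right)^{\frac1{n-2}}}\frac{\partial_rC(R)-\partial_rA(R)y^{-(n-2)}}{(C(R)-A(R)y^{-(n-2)})^{3/2}}dy\le\max(0,2\partial_rt_*(R));$$ (5) $\partial_rA(R)\big(R^{-(n-2)}+v_0(R)^2/A(R)\big)\le\partial_rC(R)$, where $$t_*(R):=\left(A(R)C(R)^{-\frac n2}\right)^{\frac1{n-2}}\int_1^{R\left(\frac{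A(R)}{C(R)}\right)^{-\frac1{n-2}}}\frac{dz}{\sqrt{1-z^{-(n-2)}}}.$$
   Context: Data: $\rho_0\in C([0,\infty))$, $\rho_0\ge0$; $v_0\in C([0,\infty))\cap C^1((0,\infty))$ with $v_0(0)=0$. Put $m_0(r)=\int_0^r\rho_0(s)s^{n-1}ds$, $A(r)=\frac{2|\lambda|m_0(r)}{n-2}$, $C(r)=v_0(r)^2+A(r)r^{-(n-2)}$. For each $R>0$, $X(t,R)$ (the characteristic curve of the radial Euler-Poisson system) is the solution of $$X''(t,R)=-\frac{\lambda m_0(R)}{X(t,R)^{n-1}},\quad X'(0,R)=v_0(R),\quad X(0,R)=R,$$ where $'$ is the $t$-derivative, continued up to the first time (if any) at which $X$ reaches $0$; and $\Gamma(t,R)=\partial_RX(t,R)$. A necessary and sufficient condition for the existence of $t_c\in(0,\infty)$ with $X(t_c,R)=0$ or $\Gamma(t_c,R)=0$ is called a pointwise condition for finite-time breakdown (PCFB) at $R$. Conditions (1)-(5) need only be read when $A(R)>0$. A divergent integral of a nonnegative function is $+\infty$. *)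

theory Defs
  imports "HOL-Analysis.Analysis"
begin

definition mass0 :: "nat \<Rightarrow> (real \<Rightarrow> real) \<Rightarrow> real \<Rightarrow> real" where
  "mass0 n \<rho>0 r = (LBINT s=0..r. \<rho>0 s * s ^ (n - 1))"

definition A_fun :: "real \<Rightarrow> nat \<Rightarrow> (real \<Rightarrow> real) \<Rightarrow> real \<Rightarrow> real" where
  "A_fun lam n \<rho>0 r = 2 * \<bar>lam\<bar> * mass0 n \<rho>0 r / (real n - 2)"

definition C_fun :: "real \<Rightarrow> nat \<Rightarrow> (real \<Rightarrow> real) \<Rightarrow> (real \<Rightarrow> real) \<Rightarrow> real \<Rightarrow> real" where
  "C_fun lam n \<rho>0 v0 r = (v0 r)\<^sup>2 + A_fun lam n \<rho>0 r / r ^ (n - 2)"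

definition t_star :: "real \<Rightarrow> nat \<Rightarrow> (real \<Rightarrow> real) \<Rightarrow> (real \<Rightarrow> real) \<Rightarrow> real \<Rightarrow> real" where
  "t_star lam n \<rho>0 v0 r =
     (A_fun lam n \<rho>0 r * C_fun lam n \<rho>0 v0 r powr (- (real n / 2))) powr (1 / (real n - 2)) *
     (LBINT z=1..r * (A_fun lam n \<rho>0 r / C_fun lam n \<rho>0 v0 r) powr (- (1 / (real n - 2))).
        1 / sqrt (1 - 1 / z ^ (n - 2)))"

text \<open>
  A curve is represented by a total function of time, of which only the part up to and including
  the first zero is meaningful; \<open>in_lifespan x t\<close> says that \<open>t\<close> belongs to that part.
\<close>

definition in_lifespan :: "(real \<Rightarrow> real) \<Rightarrow> real \<Rightarrow> bool" where
  "in_lifespan x t \<longleftrightarrow> 0 \<le> t \<and> (\<forall>s\<in>{0..<t}. 0 < x s)"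

text \<open>
  The equation is imposed as long as the curve is positive, with the one-sided derivative at time
  \<open>0\<close>. At a first zero, where the right-hand side is singular, only continuity from the
  left is required. This determines the curve on its lifespan, and forces the lifespan to be
  \<open>[0, \<infinity>)\<close> if zero is never reached.
\<close>

definition characteristic_curve ::
    "real \<Rightarrow> nat \<Rightarrow> (real \<Rightarrow> real) \<Rightarrow> (real \<Rightarrow> real) \<Rightarrow> real \<Rightarrow> (real \<Rightarrow> real) \<Rightarrow> bool" where
  "characteristic_curve lam n \<rho>0 v0 R x \<longleftrightarrow>
     x 0 = R \<and>
     (\<exists>x'. x' 0 = v0 R \<and>
        (\<forall>t. in_lifespan x t \<and> 0 < x t \<longrightarrow>
           (x has_real_derivative x' t) (at t within {0..}) \<and>
           (x' has_real_derivative - (lam * mass0 n \<rho>0 R / x t ^ (n - 1))) (at t within {0..}))) \<and>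
     (\<forall>t. in_lifespan x t \<longrightarrow> continuous (at t within {0..t}) x)"

definition Gamma :: "(real \<Rightarrow> real \<Rightarrow> real) \<Rightarrow> real \<Rightarrow> real \<Rightarrow> real" where
  "Gamma X t R = deriv (\<lambda>r. X t r) R"

text \<open>
  \<open>deriv\<close> is unspecified at points of non-differentiability, so a zero of \<open>Gamma\<close>
  counts only where the derivative exists.
\<close>

definition finite_time_breakdown :: "(real \<Rightarrow> real \<Rightarrow> real) \<Rightarrow> real \<Rightarrow> bool" where
  "finite_time_breakdown X R \<longleftrightarrow>
     (\<exists>tc>0. in_lifespan (\<lambda>t. X t R) tc \<and>
        (X tc R = 0 \<or> ((\<lambda>r. X tc r) differentiable (at R) \<and> Gamma X tc R = 0)))"

end

theory Submission imports Defs begin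

text \<open>
  Put \<open>k = n - 2\<close>. If \<open>A(R) = 0\<close>, the curve is a straight line that reaches \<open>0\<close>. Otherwise
  energy conservation \<open>X'\<^sup>2 = C - A X\<^bsup>-k\<^esup>\<close> gives \<open>X = a \<phi>(b (t - t\<^sub>*))\<close> with
  \<open>a = (A/C)\<^bsup>1/k\<^esup>\<close>, \<open>b = C\<^bsup>1/2\<^esup>/a\<close>, and one even profile \<open>\<phi>\<close>, the inverse of
  \<open>G(z) = \<integral>\<^sub>1\<^sup>z (1 - u\<^bsup>-k\<^esup>)\<^bsup>-1/2\<^esup> du\<close>. In particular \<open>X\<close> never vanishes, and the chain rule gives
  \<open>\<Gamma> = (a'/a) X + X' ((b'/b) (t - t\<^sub>*) - t\<^sub>*')\<close>.

  At the turning point \<open>\<Gamma>(t\<^sub>*) = a'\<close>, while \<open>\<Gamma>(0) = 1\<close>; so \<open>a' \<le> 0\<close>, which is condition (5), forces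
  a zero. If \<open>a' > 0\<close>, then \<open>\<Gamma>/X'\<close> equals \<open>h(X) - 2 t\<^sub>*'\<close> after \<open>t\<^sub>*\<close> and \<open>-h(X)\<close> before, where
  \<open>h(R) = 1/|v\<^sub>0(R)|\<close> and \<open>h'(y) = (C' - A' y\<^bsup>-k\<^esup>)/(2 (C - A y\<^bsup>-k\<^esup>)\<^bsup>3/2\<^esup>)\<close>. Hence a zero exists iff
  \<open>h \<le> 2 t\<^sub>*'\<close> somewhere on \<open>(a, \<infinity>)\<close> or \<open>h \<le> 0\<close> somewhere on \<open>(a, R)\<close>, and the sign of \<open>C'\<close> together
  with the position of the minimum \<open>(A'/C')\<^bsup>1/k\<^esup>\<close> of \<open>h\<close> relative to \<open>R\<close> gives conditions (1)--(4).
\<close>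

section \<open>The travel time of the rescaled profile\<close>

text \<open>Reciprocal of the rescaled speed: for \<open>u = X / a\<close>, energy conservation
  reads \<open>\<bar>X'\<bar> * prof k u = sqrt C\<close> away from the turning point. At
  \<open>u = 1\<close> division by zero gives the value 0, which no integral sees.\<close>

definition prof :: "nat \<Rightarrow> real \<Rightarrow> real" where
  "prof k u = 1 / sqrt (1 - 1 / u ^ k)"

definition prof_time :: "nat \<Rightarrow> real \<Rightarrow> real" where
  "prof_time k z = (LBINT u=1..z. prof k u)"

lemma prof_radicand:
  fixes u :: real
  assumes "0 < k" "1 < u" shows "0 < 1 - 1 / u ^ k" "1 - 1 / u ^ k < 1"
proof -
  have "1 < u ^ k" using assms by (intro one_less_power)
  then show "0 < 1 - 1 / u ^ k" "1 - 1 / u ^ k < 1" by simp_all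
qed

lemma prof_pos: "0 < k \<Longrightarrow> 1 < u \<Longrightarrow> 0 < prof k u"
  using prof_radicand[of k u] by (simp add: prof_def)

lemma isCont_prof: "0 < k \<Longrightarrow> 1 < u \<Longrightarrow> isCont (prof k) u"
  unfolding prof_def using one_less_power[of u k, THEN less_imp_neq] by (intro continuous_intros) auto

lemma prof_measurable [measurable]: "prof k \<in> borel_measurable borel"
  unfolding prof_def by measurable

text \<open>The singularity at 1 is only of inverse square root type, because
  \<open>1 - 1 / u ^ k\<close> is at least \<open>(u - 1) / u\<close>. The majorant has an
  elementary primitive.\<close>

lemma prof_le:
  assumes "0 < k" "1 < u" "u \<le> Z" shows "prof k u \<le> sqrt Z / sqrt (u - 1)"
proof -
  have "u ^ 1 \<le> u ^ k" using assms by (intro power_increasing) auto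
  then have "1 / u ^ k \<le> 1 / u" using assms by (simp add: frac_le)
  moreover have "(u - 1) / Z \<le> (u - 1) / u"
    using assms by (intro divide_left_mono) auto
  moreover have "(u - 1) / u = 1 - 1 / u"
    using assms by (simp add: diff_divide_distrib)
  ultimately have "(u - 1) / Z \<le> 1 - 1 / u ^ k" by linarith
  moreover have "0 < (u - 1) / Z" using assms by simp
  ultimately have "1 / sqrt (1 - 1 / u ^ k) \<le> 1 / sqrt ((u - 1) / Z)"
    by (intro divide_left_mono) (auto simp: real_sqrt_le_iff)
  also have "\<dots> = sqrt Z / sqrt (u - 1)" by (simp add: real_sqrt_divide)
  finally show ?thesis by (simp add: prof_def)
qed

lemma prof_integrable:
  assumes "0 < k" shows "set_integrable lborel {1..Z} (prof k)"
proof (cases "1 < Z")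
  case False
  then consider "{1..Z} = {}" | "{1..Z} = {1}" by fastforce
  then show ?thesis
  proof cases
    case 2
    have "AE x in lborel. indicat_real {1..Z} x *\<^sub>R prof k x = 0"
      using AE_lborel_singleton[of "1::real"] by eventually_elim (simp add: 2)
    then show ?thesis
      unfolding set_integrable_def by (subst integrable_cong_AE[where g = "\<lambda>_. 0"]) auto
  qed (simp add: set_integrable_def)
next
  case True
  \<comment> \<open>The primitive \<open>2 * sqrt Z * sqrt (u - 1)\<close> is continuous up to 1, so
    the fundamental theorem with one-sided limits at the endpoints applies despite the
    singularity.\<close>
  have "set_integrable lborel (einterval (ereal 1) (ereal Z)) (\<lambda>u. sqrt Z / sqrt (u - 1))"
  proof (rule interval_integral_FTC_nonneg(1))
    show "ereal 1 < ereal Z" using True by simp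
    fix x assume "ereal 1 < ereal x" "ereal x < ereal Z"
    then have x: "1 < x" "x < Z" by auto
    show "((\<lambda>u. 2 * sqrt Z * sqrt (u - 1)) has_real_derivative sqrt Z / sqrt (x - 1)) (at x)"
      using x by (auto intro!: derivative_eq_intros simp: field_simps)
    show "isCont (\<lambda>u. sqrt Z / sqrt (u - 1)) x"
      using x by (intro continuous_intros) auto
  next
    show "AE x in lborel. ereal 1 < ereal x \<longrightarrow> ereal x < ereal Z \<longrightarrow> 0 \<le> sqrt Z / sqrt (x - 1)"
      by (auto simp: True less_imp_le)
    have c: "isCont (\<lambda>u. 2 * sqrt Z * sqrt (u - 1)) y" for y by (intro continuous_intros)
    have "((\<lambda>u. 2 * sqrt Z * sqrt (u - 1)) \<longlongrightarrow> 0) (at_right 1)"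
      using c[of 1] by (simp add: isCont_def filterlim_at_split)
    then show "(((\<lambda>u. 2 * sqrt Z * sqrt (u - 1)) \<circ> real_of_ereal) \<longlongrightarrow> 0) (at_right (ereal 1))"
      by (simp add: ereal_tendsto_simps1)
    have "((\<lambda>u. 2 * sqrt Z * sqrt (u - 1)) \<longlongrightarrow> 2 * sqrt Z * sqrt (Z - 1)) (at_left Z)"
      using c[of Z] by (simp add: isCont_def filterlim_at_split)
    then show "(((\<lambda>u. 2 * sqrt Z * sqrt (u - 1)) \<circ> real_of_ereal) \<longlongrightarrow> 2 * sqrt Z * sqrt (Z - 1)) (at_left (ereal Z))"
      by (simp add: ereal_tendsto_simps1)
  qed
  then have "set_integrable lborel {1<..<Z} (\<lambda>u. sqrt Z / sqrt (u - 1))" by simp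
  then have "set_integrable lborel {1<..<Z} (prof k)"
  proof (rule set_integrable_bound)
    show "set_borel_measurable lborel {1<..<Z} (prof k)"
      unfolding set_borel_measurable_def by measurable
    show "AE x in lborel. x \<in> {1<..<Z} \<longrightarrow> norm (prof k x) \<le> norm (sqrt Z / sqrt (x - 1))"
    proof (intro AE_I2 impI)
      fix x assume "x \<in> {1<..<Z}"
      then show "norm (prof k x) \<le> norm (sqrt Z / sqrt (x - 1))"
        using prof_le[of k x Z] prof_pos[of k x] assms by auto
    qed
  qed
  moreover have "set_integrable lborel {1<..<Z} (prof k) = set_integrable lborel {1..Z} (prof k)"
    unfolding set_integrable_def
  proof (rule integrable_cong_AE)
    show "AE x in lborel. indicat_real {1<..<Z} x *\<^sub>R prof k x = indicat_real {1..Z} x *\<^sub>R prof k x"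
      using AE_lborel_singleton[of "1::real"] AE_lborel_singleton[of Z]
      by eventually_elim (auto simp: indicator_def)
  qed auto
  ultimately show ?thesis by blast
qed

lemma prof_time_eq_integral:
  assumes "0 < k" "1 \<le> z" shows "prof_time k z = integral {1..z} (prof k)"
  unfolding prof_time_def
  using interval_integral_eq_integral[OF assms(2) prof_integrable[OF assms(1)]] by (simp add: one_ereal_def)

lemma prof_integrable_on:
  assumes "0 < k" shows "prof k integrable_on {1..Z}"
  using set_borel_integral_eq_integral(1)[OF prof_integrable[OF assms]] .

lemma prof_time_1 [simp]: "prof_time k 1 = 0"
  by (simp add: prof_time_def one_ereal_def)

text \<open>The endpoint 1 has to be included: it is the turning point, where differentiability
  fails and the two halves of a curve are glued.\<close>

lemma continuous_on_prof_time:
  assumes "0 < k" shows "continuous_on {1..} (prof_time k)"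
proof -
  have c: "continuous_on {1..Z} (prof_time k)" for Z
    by (rule continuous_on_eq[OF indefinite_integral_continuous_1[OF prof_integrable_on[OF assms]]])
       (use assms in \<open>auto simp: prof_time_eq_integral\<close>)
  have "continuous (at z within {1..}) (prof_time k)" if "1 \<le> z" for z
  proof -
    have "continuous (at z within {1..z+1}) (prof_time k)"
      using c[of "z+1"] that by (auto simp: continuous_on_eq_continuous_within)
    moreover have "at z within {1..z+1} = at z within {1..}"
      by (rule at_within_nhd[of _ "{..<z+1}"]) auto
    ultimately show ?thesis by simp
  qed
  then show ?thesis by (auto simp: continuous_on_eq_continuous_within)
qed

lemma prof_time_deriv:
  assumes "0 < k" "1 < z" shows "(prof_time k has_real_derivative prof k z) (at z)"
proof -
  have "((\<lambda>u. integral {1..u} (prof k)) has_vector_derivative prof k z) (at z within {1..z+1})"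
    using assms integral_has_vector_derivative_continuous_at
        [OF prof_integrable_on[OF assms(1), of "z + 1"], of z "{}"]
      continuous_at_imp_continuous_at_within[OF isCont_prof, of k z] by auto
  then have "((\<lambda>u. integral {1..u} (prof k)) has_real_derivative prof k z) (at z within {1<..<z+1})"
    by (auto simp: has_real_derivative_iff_has_vector_derivative intro: has_vector_derivative_within_subset)
  then have "((\<lambda>u. integral {1..u} (prof k)) has_real_derivative prof k z) (at z)"
    using assms by (subst (asm) at_within_open) auto
  then show ?thesis
    by (rule has_field_derivative_transform_within_open[of _ _ _ "{1<..}"])
       (use assms prof_time_eq_integral in auto)
qed

lemma prof_time_strict_mono:
  assumes "0 < k" "1 \<le> y" "y < z" shows "prof_time k y < prof_time k z"
proof (rule DERIV_pos_imp_increasing_open[OF assms(3)])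
  show "continuous_on {y..z} (prof_time k)"
    by (rule continuous_on_subset[OF continuous_on_prof_time[OF assms(1)]]) (use assms in auto)
  fix x assume "y < x" "x < z"
  then show "\<exists>d. (prof_time k has_real_derivative d) (at x) \<and> 0 < d"
    using assms prof_time_deriv[of k x] prof_pos[of k x] by auto
qed

text \<open>Replaces the inverse profile, which is never constructed: positions are identified
  through their travel times.\<close>

lemma prof_time_inject:
  assumes "0 < k" "1 \<le> y" "1 \<le> z" "prof_time k y = prof_time k z" shows "y = z"
  using prof_time_strict_mono[of k y z] prof_time_strict_mono[of k z y] assms by fastforce

lemma prof_time_pos: "0 < k \<Longrightarrow> 1 < z \<Longrightarrow> 0 < prof_time k z"
  using prof_time_strict_mono[of k 1 z] by simp

section \<open>Single characteristic curves\<close>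

text \<open>Conservation principle: every time before a positive point of the lifespan is again such
  a point, so the derivative vanishes on all of \<open>{0..t}\<close>.\<close>

lemma zero_derivative_on_lifespan:
  fixes f x :: "real \<Rightarrow> real"
  assumes df: "\<And>t. in_lifespan x t \<Longrightarrow> 0 < x t \<Longrightarrow> (f has_real_derivative 0) (at t within {0..})"
    and t: "in_lifespan x t" "0 < x t"
  shows "f t = f 0"
proof -
  have "(f has_real_derivative 0) (at s within {0..t})" if "s \<in> {0..t}" for s
  proof (rule has_field_derivative_subset[OF df])
    show "in_lifespan x s" "0 < x s" using t that by (auto simp: in_lifespan_def less_le)
  qed auto
  then obtain c where "\<forall>s\<in>{0..t}. f s = c"
    using has_field_derivative_zero_constant[of "{0..t}" f] by auto
  moreover have "0 \<in> {0..t}" "t \<in> {0..t}" using t by (auto simp: in_lifespan_def)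
  ultimately show ?thesis by metis
qed

text \<open>Multiplying the equation of motion by \<open>2 * x'\<close> turns both sides into total
  derivatives.\<close>

lemma curve_energy:
  assumes "0 < R" "x 0 = R"
    and dx: "\<And>t. in_lifespan x t \<Longrightarrow> 0 < x t \<Longrightarrow> (x has_real_derivative x' t) (at t within {0..})"
    and dx': "\<And>t. in_lifespan x t \<Longrightarrow> 0 < x t \<Longrightarrow>
      (x' has_real_derivative real k * A / 2 / x t ^ (k + 1)) (at t within {0..})"
    and t: "in_lifespan x t" "0 < x t"
  shows "(x' t)\<^sup>2 + A / x t ^ k = (x' 0)\<^sup>2 + A / R ^ k"
proof -
  have "((\<lambda>s. (x' s)\<^sup>2 + A / x s ^ k) has_real_derivative 0) (at s within {0..})"
    if s: "in_lifespan x s" "0 < x s" for s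
  proof -
    \<comment> \<open>Matches the squared denominator of the quotient rule with the one in the
      force. For \<open>k = 0\<close> the force and the derivative of the potential both
      vanish.\<close>
    have "x s ^ k * x s ^ k = x s ^ (k + 1) * x s ^ (k - 1)" if "k \<noteq> 0"
      using that by (cases k) auto
    then show ?thesis
      using s by (auto intro!: derivative_eq_intros dx[OF s] dx'[OF s] simp: field_simps)
  qed
  from zero_derivative_on_lifespan[OF this t] show ?thesis using assms(2) by simp
qed

text \<open>First-zero argument. The infimum \<open>T\<close> of the times with nonpositive value
  lies in the lifespan, \<open>step\<close> makes \<open>x T\<close> positive, and continuity keeps
  \<open>x\<close> positive a little beyond \<open>T\<close>. Continuity is asked for only at
  positive points, where the equation supplies it.\<close>

lemma pos_until:
  fixes x :: "real \<Rightarrow> real"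
  assumes "0 < x 0"
    and cont: "\<And>T. in_lifespan x T \<Longrightarrow> 0 < x T \<Longrightarrow> continuous (at T within {0..}) x"
    and step: "\<And>T. 0 < T \<Longrightarrow> T \<le> t \<Longrightarrow> in_lifespan x T \<Longrightarrow> 0 < x T"
    and "0 \<le> t"
  shows "0 < x t"
proof (rule ccontr)
  assume "\<not> 0 < x t"
  define S where "S = {s. 0 \<le> s \<and> x s \<le> 0}"
  define T where "T = Inf S"
  have S: "S \<noteq> {}" "bdd_below S" "t \<in> S"
    using \<open>\<not> 0 < x t\<close> \<open>0 \<le> t\<close> by (auto simp: S_def intro!: bdd_belowI[of _ 0])
  have T0: "0 \<le> T" unfolding T_def using S by (intro cInf_greatest) (auto simp: S_def)
  have below: "0 < x s" if "0 \<le> s" "s < T" for s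
    using that cInf_lower[of s S] S unfolding T_def S_def by fastforce
  have T: "in_lifespan x T" using T0 below by (auto simp: in_lifespan_def)
  have "T \<le> t" unfolding T_def using S by (intro cInf_lower)
  then have "0 < x T" using assms(1) step[OF _ _ T] T0 by (cases "T = 0") auto
  then have "continuous (at T within {0..}) x" using cont T by blast
  then obtain d where d: "0 < d" "\<And>s. 0 \<le> s \<Longrightarrow> dist s T < d \<Longrightarrow> dist (x s) (x T) < x T"
    using \<open>0 < x T\<close> unfolding continuous_within_eps_delta by (metis atLeast_iff)
  have "T + d \<le> T" unfolding T_def
  proof (rule cInf_greatest[OF S(1)])
    fix s assume s: "s \<in> S"
    have "T \<le> s" unfolding T_def using s S by (intro cInf_lower)
    then show "Inf S + d \<le> s"
      using d(2)[of s] s by (fold T_def) (force simp: S_def dist_real_def abs_less_iff)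
  qed
  then show False using d by simp
qed

text \<open>At a possible first zero only left continuity is known, so a formula \<open>f\<close>
  valid before \<open>T\<close> is carried over to \<open>T\<close> as a left limit.\<close>

lemma in_lifespan_limit:
  assumes cont: "continuous (at T within {0..T}) x" and "0 < T" and T: "in_lifespan x T"
    and f: "\<And>s. in_lifespan x s \<Longrightarrow> 0 < x s \<Longrightarrow> s < T \<Longrightarrow> f s = x s"
  shows "(f \<longlongrightarrow> x T) (at_left T)"
proof -
  have "(x \<longlongrightarrow> x T) (at_left T)"
    using cont \<open>0 < T\<close> by (simp add: continuous_within at_within_Icc_at_left)
  moreover have "eventually (\<lambda>s. x s = f s) (at_left T)"
  proof (rule eventually_at_leftI[OF _ \<open>0 < T\<close>])
    fix s assume "s \<in> {0<..<T}"
    then show "x s = f s" using T by (intro f[symmetric]) (auto simp: in_lifespan_def)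
  qed
  ultimately show ?thesis by (rule Lim_transform_eventually)
qed

text \<open>The repulsive potential is a barrier: energy conservation forces
  \<open>A / x t ^ k \<le> C\<close>, hence \<open>x t \<ge> a\<close>, and this bound survives the
  left limit at a supposed first zero.\<close>

lemma curve_pos:
  assumes "0 < k" "0 < A" "0 < R" "x 0 = R"
    and dx: "\<And>t. in_lifespan x t \<Longrightarrow> 0 < x t \<Longrightarrow> (x has_real_derivative x' t) (at t within {0..})"
    and dx': "\<And>t. in_lifespan x t \<Longrightarrow> 0 < x t \<Longrightarrow>
      (x' has_real_derivative real k * A / 2 / x t ^ (k + 1)) (at t within {0..})"
    and cx: "\<And>t. in_lifespan x t \<Longrightarrow> continuous (at t within {0..t}) x"
    and "0 \<le> t"
  shows "0 < x t"
proof (rule pos_until[OF _ DERIV_continuous[OF dx] _ \<open>0 \<le> t\<close>])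
  show "0 < x 0" using assms by simp
  fix T assume "0 < T" and T: "in_lifespan x T"
  define C where "C = (x' 0)\<^sup>2 + A / R ^ k"
  define a where "a = root k (A / C)"
  have "0 < C" using assms by (auto simp: C_def intro: add_nonneg_pos)
  then have a: "0 < a" "a ^ k = A / C" using assms by (auto simp: a_def)
  \<comment> \<open>The inequality \<open>a \<le> x s\<close> is written as an equation so that it
    fits \<open>in_lifespan_limit\<close>.\<close>
  have lower: "max a (x s) = x s" if "in_lifespan x s" "0 < x s" for s
  proof -
    have "(x' s)\<^sup>2 + A / x s ^ k = C"
      unfolding C_def using curve_energy[OF assms(3,4) dx dx' that] .
    then have "A / x s ^ k \<le> C" using zero_le_power2[of "x' s"] by linarith
    then have "A / C \<le> x s ^ k" using that \<open>0 < C\<close> by (simp add: field_simps)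
    then have "a \<le> x s" using a that \<open>0 < k\<close> by (metis less_imp_le power_mono_iff)
    then show ?thesis by simp
  qed
  have "((\<lambda>s. max a (x s)) \<longlongrightarrow> x T) (at_left T)"
    by (rule in_lifespan_limit[OF cx[OF T] \<open>0 < T\<close> T]) (rule lower)
  then have "a \<le> x T" by (rule tendsto_lowerbound) auto
  then show "0 < x T" using a by simp
qed

text \<open>As long as the curve moves inwards it stays below \<open>R\<close>, so its acceleration
  is at least the initial one, \<open>c\<close>. The velocity must then reach 0 no later than time
  \<open>- x' 0 / c\<close>.\<close>

lemma curve_turning_point:
  fixes x x' :: "real \<Rightarrow> real"
  assumes "0 < k" "0 < A" "0 < R" "x 0 = R" "x' 0 < 0"
    and pos: "\<And>t. 0 \<le> t \<Longrightarrow> 0 < x t"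
    and dx: "\<And>t. 0 < t \<Longrightarrow> (x has_real_derivative x' t) (at t)"
    and dx': "\<And>t. 0 < t \<Longrightarrow> (x' has_real_derivative real k * A / 2 / x t ^ (k + 1)) (at t)"
    and cx: "continuous_on {0..} x" and cx': "continuous_on {0..} x'"
  obtains t where "0 < t" "x' t = 0"
proof -
  define c where "c = real k * A / 2 / R ^ (k + 1)"
  define t where "t = - x' 0 / c"
  have "0 < c" using assms by (simp add: c_def)
  then have "0 < t" using assms(5) by (simp add: t_def divide_neg_pos)
  have "\<exists>s\<in>{0..t}. x' s = 0"
  proof (rule ccontr)
    assume nz: "\<not> (\<exists>s\<in>{0..t}. x' s = 0)"
    have neg: "x' s < 0" if "0 \<le> s" "s \<le> t" for s
    proof (rule ccontr)
      assume "\<not> x' s < 0"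
      moreover have "continuous_on {0..s} x'" by (rule continuous_on_subset[OF cx']) auto
      ultimately have "\<exists>y\<ge>0. y \<le> s \<and> x' y = 0"
        using that(1) assms(5) by (intro IVT') auto
      then obtain y where "0 \<le> y" "y \<le> s" "x' y = 0" by blast
      then show False using nz that by auto
    qed
    have xle: "x s \<le> R" if "0 \<le> s" "s \<le> t" for s
    proof -
      have "x s \<le> x 0"
        using that neg continuous_on_subset[OF cx, of "{0..s}"]
        by (intro DERIV_nonpos_imp_decreasing_open[of 0 s x]) 
          (auto intro!: exI[of _ "x' _"] dx less_imp_le)
      then show ?thesis using assms by simp
    qed
    have "x' 0 - c * 0 \<le> x' t - c * t"
    proof (rule DERIV_nonneg_imp_increasing_open[where f = "\<lambda>s. x' s - c * s"])
      show "continuous_on {0..t} (\<lambda>s. x' s - c * s)"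
        using continuous_on_subset[OF cx', of "{0..t}"] by (intro continuous_intros) auto
      fix s assume s: "0 < s" "s < t"
      have "c \<le> real k * A / 2 / x s ^ (k + 1)"
        unfolding c_def using s assms(1-3) pos[of s] xle[of s]
        by (intro divide_left_mono power_mono mult_pos_pos zero_less_power) auto
      moreover have "((\<lambda>s. x' s - c * s) has_real_derivative
          real k * A / 2 / x s ^ (k + 1) - c) (at s)"
        using dx'[OF s(1)] by (auto intro!: derivative_eq_intros)
      ultimately show "\<exists>y. ((\<lambda>s. x' s - c * s) has_real_derivative y) (at s) \<and> 0 \<le> y"
        by force
    qed (use \<open>0 < t\<close> in simp)
    then show False using neg[of t] \<open>0 < t\<close> \<open>0 < c\<close> by (simp add: t_def)
  qed
  then obtain s where "0 \<le> s" "x' s = 0" by auto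
  then show thesis using that[of s] assms(5) by (cases "s = 0") auto
qed

text \<open>In the variable \<open>x / a\<close> the energy identity says that
  \<open>prof_time\<close> changes at rate \<open>-b\<close> before the turning point and
  \<open>b\<close> after it; since it vanishes at the turning point, it equals \<open>b\<close>
  times the distance in time to that point.\<close>

lemma curve_time_law:
  fixes x x' :: "real \<Rightarrow> real"
  assumes k: "0 < k" and A: "0 < A" and R: "0 < R" and x0: "x 0 = R" and v: "x' 0 < 0"
    and pos: "\<And>t. 0 \<le> t \<Longrightarrow> 0 < x t"
    and dx: "\<And>t. 0 < t \<Longrightarrow> (x has_real_derivative x' t) (at t)"
    and dx': "\<And>t. 0 < t \<Longrightarrow> (x' has_real_derivative real k * A / 2 / x t ^ (k + 1)) (at t)"
    and cx: "continuous_on {0..} x" and cx': "continuous_on {0..} x'"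
    and energy: "\<And>t. 0 \<le> t \<Longrightarrow> (x' t)\<^sup>2 + A / x t ^ k = C"
    and a: "0 < a" "a ^ k = A / C"
  defines "b \<equiv> sqrt C / a"
  defines "t0 \<equiv> prof_time k (R / a) / b"
  shows "0 < C" "0 < b" "a < R" "0 < t0" "x t0 = a" "x' t0 = 0"
    and "\<And>t. 0 \<le> t \<Longrightarrow> a \<le> x t"
    and "\<And>t. 0 \<le> t \<Longrightarrow> prof_time k (x t / a) = b * \<bar>t - t0\<bar>"
    and "\<And>t. 0 \<le> t \<Longrightarrow> t \<noteq> t0 \<Longrightarrow> a < x t \<and> x' t * prof k (x t / a) = sgn (t - t0) * (a * b)"
proof -
  obtain t1 where t1: "0 < t1" "x' t1 = 0"
    using curve_turning_point[OF k A R x0 v pos dx dx' cx cx'] by blast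
  show C: "0 < C"
    using energy[of 0] pos[of 0] A by (smt (verit) divide_pos_pos zero_le_power2 zero_less_power)
  then show b: "0 < b" using a by (simp add: b_def)
  \<comment> \<open>The force is repulsive, so the velocity increases strictly: \<open>t1\<close> is
    its only zero and its sign is that of \<open>t - t1\<close>.\<close>
  have mono: "x' s < x' t" if "0 \<le> s" "s < t" for s t
  proof (rule DERIV_pos_imp_increasing_open[OF that(2)])
    show "continuous_on {s..t} x'"
      by (rule continuous_on_subset[OF cx']) (use that in auto)
    fix y assume "s < y" "y < t"
    then show "\<exists>d. (x' has_real_derivative d) (at y) \<and> 0 < d"
      using that dx'[of y] pos[of y] k A by (intro exI[of _ "real k * A / 2 / x y ^ (k + 1)"]) auto
  qed
  have sq: "(x' t / (a * b))\<^sup>2 = 1 - 1 / (x t / a) ^ k" if "0 \<le> t" for t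
  proof -
    have "(a * b)\<^sup>2 = C" using C a by (simp add: b_def)
    moreover have "A / C / x t ^ k = 1 / (x t / a) ^ k"
      using a by (simp add: power_divide)
    moreover have "(x' t)\<^sup>2 = C * (1 - A / C / x t ^ k)"
      using energy[OF that] C by (simp add: algebra_simps)
    ultimately show ?thesis using C by (simp add: power_divide)
  qed
  show ge: "a \<le> x t" if "0 \<le> t" for t
  proof (rule ccontr)
    assume "\<not> a \<le> x t"
    then have "x t / a < 1" "0 < x t / a" using a pos[OF that] by simp_all
    then have "1 < 1 / (x t / a) ^ k" using k by (simp add: power_less_one_iff)
    then show False using sq[OF that] by (smt (verit) zero_le_power2)
  qed
  have gt: "a < x t" if "0 \<le> t" "t \<noteq> t1" for t
  proof -
    have "x' t \<noteq> 0" using mono[of t t1] mono[of t1 t] that t1 by fastforce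
    then have "(x' t / (a * b))\<^sup>2 \<noteq> 0" using a b by simp
    then have "x t \<noteq> a" using sq[OF that(1)] a by auto
    then show ?thesis using ge[OF that(1)] by simp
  qed
  have speed: "x' t * prof k (x t / a) = sgn (t - t1) * (a * b)" if "0 \<le> t" "t \<noteq> t1" for t
  proof -
    have z: "0 < sqrt (1 - 1 / (x t / a) ^ k)"
      using prof_radicand(1)[OF k, of "x t / a"] gt[OF that] a by simp
    have "sqrt (1 - 1 / (x t / a) ^ k) = \<bar>x' t\<bar> / (a * b)"
      using a b by (simp flip: sq[OF that(1)] add: abs_divide abs_mult)
    moreover have "x' t = sgn (t - t1) * \<bar>x' t\<bar>"
      using mono[of t t1] mono[of t1 t] that t1 by (cases t t1 rule: linorder_cases) auto
    ultimately have "x' t = sgn (t - t1) * (a * b) * sqrt (1 - 1 / (x t / a) ^ k)"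
      using a b by simp
    then show ?thesis using z less_imp_neq[OF z] by (simp add: prof_def del: real_sqrt_gt_0_iff)
  qed
  have xt1: "x t1 = a"
  proof -
    have "\<not> 1 < x t1 / a"
      using sq[of t1] t1 prof_radicand(1)[OF k, of "x t1 / a"] by auto
    then show ?thesis using ge[of t1] t1 a by simp
  qed
  \<comment> \<open>Continuity across \<open>t1\<close> is needed because the derivative below
    exists only away from \<open>t1\<close>.\<close>
  have cG: "continuous_on {0..} (\<lambda>t. prof_time k (x t / a))"
    by (rule continuous_on_compose2[OF continuous_on_prof_time[OF k]])
      (use ge a in \<open>auto intro!: continuous_intros cx\<close>)
  have dG: "((\<lambda>t. prof_time k (x t / a)) has_real_derivative sgn (t - t1) * b) (at t)"
    if "0 < t" "t \<noteq> t1" for t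
  proof -
    have "((\<lambda>t. prof_time k (x t / a)) has_real_derivative prof k (x t / a) * (x' t / a)) (at t)"
      using gt[of t] that a
      by (intro DERIV_chain2[OF prof_time_deriv[OF k]] DERIV_cdivide dx) auto
    moreover have "prof k (x t / a) * (x' t / a) = sgn (t - t1) * b"
      using speed[of t] that a by (simp add: field_simps)
    ultimately show ?thesis by simp
  qed
  have law: "prof_time k (x t / a) = b * \<bar>t - t1\<bar>" if "0 \<le> t" for t
  proof (cases t t1 rule: linorder_cases)
    case less
    have "prof_time k (x t1 / a) + b * t1 = prof_time k (x t / a) + b * t"
    proof (rule DERIV_isconst_end[OF less, of "\<lambda>t. prof_time k (x t / a) + b * t"])
      show "continuous_on {t..t1} (\<lambda>t. prof_time k (x t / a) + b * t)"
        by (intro continuous_intros continuous_on_subset[OF cG]) (use that in auto)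
      fix s assume "t < s" "s < t1"
      then show "((\<lambda>t. prof_time k (x t / a) + b * t) has_real_derivative 0) (at s)"
        using that by (auto intro!: derivative_eq_intros dG)
    qed
    then show ?thesis using less xt1 a by (simp add: algebra_simps)
  next
    case greater
    have "prof_time k (x t / a) - b * t = prof_time k (x t1 / a) - b * t1"
    proof (rule DERIV_isconst_end[OF greater, of "\<lambda>t. prof_time k (x t / a) - b * t"])
      show "continuous_on {t1..t} (\<lambda>t. prof_time k (x t / a) - b * t)"
        by (intro continuous_intros continuous_on_subset[OF cG]) (use t1 in auto)
      fix s assume "t1 < s" "s < t"
      then show "((\<lambda>t. prof_time k (x t / a) - b * t) has_real_derivative 0) (at s)"
        using t1 by (auto intro!: derivative_eq_intros dG)
    qed
    then show ?thesis using greater xt1 a by (simp add: algebra_simps)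
  qed (use xt1 a in simp)
  \<comment> \<open>The law at time 0, where \<open>x 0 = R\<close>, identifies the turning time
    with the explicit expression \<open>t0\<close>.\<close>
  have "t0 = t1" using law[of 0] x0 t1 b by (simp add: t0_def)
  then show "0 < t0" "x t0 = a" "x' t0 = 0" using t1 xt1 by auto
  show "a < R" using gt[of 0] t1 x0 by simp
  fix t :: real assume t: "0 \<le> t"
  show "prof_time k (x t / a) = b * \<bar>t - t0\<bar>" using law t \<open>t0 = t1\<close> by simp
  show "a < x t \<and> x' t * prof k (x t / a) = sgn (t - t0) * (a * b)" if "t \<noteq> t0"
    using gt speed t that \<open>t0 = t1\<close> by simp
qed

section \<open>Differentiation with respect to the initial radius\<close>

text \<open>Passes from the definition of a characteristic curve to the time law. The radius is
  arbitrary and the parameters enter through equations, so that the lemma applies at all radii near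
  \<open>R\<close> at once. By positivity the lifespan is the whole half-line.\<close>

lemma characteristic_curve_law:
  fixes lam :: real and \<rho>0 v0 x :: "real \<Rightarrow> real"
  assumes X: "characteristic_curve lam (k + 2) \<rho>0 v0 r x"
    and k: "0 < k" and lam: "lam < 0" and r: "0 < r" and v: "v0 r < 0"
    and A: "A = A_fun lam (k + 2) \<rho>0 r" "0 < A"
    and C: "C = C_fun lam (k + 2) \<rho>0 v0 r"
    and a: "a = (A / C) powr (1 / real k)" and b: "b = sqrt C / a"
    and t0: "t0 = prof_time k (r / a) / b"
  obtains x' where "0 < C" "0 < a" "0 < b" "a < r" "0 < t0" "x t0 = a" "x' t0 = 0"
    "x 0 = r" "x' 0 = v0 r"
    "continuous_on {0..} x" "continuous_on {0..} x'"
    "\<And>t. 0 < t \<Longrightarrow> (x has_real_derivative x' t) (at t)"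
    "\<And>t. 0 \<le> t \<Longrightarrow> a \<le> x t"
    "\<And>t. 0 \<le> t \<Longrightarrow> prof_time k (x t / a) = b * \<bar>t - t0\<bar>"
    "\<And>t. 0 \<le> t \<Longrightarrow> t \<noteq> t0 \<Longrightarrow> a < x t \<and> x' t * prof k (x t / a) = sgn (t - t0) * (a * b)"
proof -
  from X obtain x' where x0: "x 0 = r" and x'0: "x' 0 = v0 r"
    and dx: "\<And>t. in_lifespan x t \<Longrightarrow> 0 < x t \<Longrightarrow> (x has_real_derivative x' t) (at t within {0..})"
    and dx2: "\<And>t. in_lifespan x t \<Longrightarrow> 0 < x t \<Longrightarrow>
      (x' has_real_derivative - (lam * mass0 (k + 2) \<rho>0 r / x t ^ (k + 2 - 1))) (at t within {0..})"
    and cx: "\<And>t. in_lifespan x t \<Longrightarrow> continuous (at t within {0..t}) x"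
    unfolding characteristic_curve_def by blast
  \<comment> \<open>Here \<open>lam < 0\<close> enters: \<open>- lam = \<bar>lam\<bar>\<close>, so
    the force is \<open>k * A / 2\<close> over a power of the position, which is repulsive.\<close>
  have force: "- (lam * mass0 (k + 2) \<rho>0 r / y ^ (k + 2 - 1)) = real k * A / 2 / y ^ (k + 1)" for y
    using k lam A(1) by (simp add: A_fun_def)
  note dx' = dx2[unfolded force]
  have pos: "0 < x t" if "0 \<le> t" for t
    using curve_pos[OF k A(2) r x0 dx dx' cx that] .
  have life: "in_lifespan x t" if "0 \<le> t" for t
    using that pos by (auto simp: in_lifespan_def)
  have Ceq: "C = (v0 r)\<^sup>2 + A / r ^ k" using C A(1) by (simp add: C_fun_def)
  have C0: "0 < C" unfolding Ceq using A r by (simp add: add_nonneg_pos)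
  have energy: "(x' t)\<^sup>2 + A / x t ^ k = C" if "0 \<le> t" for t
    using curve_energy[OF r x0 dx dx' life[OF that] pos[OF that]] Ceq x'0 by simp
  have a0: "0 < a" using a A C0 by simp
  have ak: "a ^ k = A / C"
  proof -
    have "a ^ k = a powr real k" using a0 by (rule powr_realpow [symmetric])
    also have "\<dots> = A / C" using A C0 k unfolding a by (simp add: powr_powr)
    finally show ?thesis .
  qed
  have cxx: "continuous_on {0..} x" "continuous_on {0..} x'"
    unfolding continuous_on_eq_continuous_within
    using DERIV_continuous[OF dx[OF life pos]] DERIV_continuous[OF dx'[OF life pos]] by blast+
  have at: "at t within {0..} = at t" if "0 < t" for t :: real
    using that by (intro at_within_interior) simp
  have d: "(x has_real_derivative x' t) (at t)"
    "(x' has_real_derivative real k * A / 2 / x t ^ (k + 1)) (at t)" if "0 < t" for t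
    using dx[OF life pos, of t] dx'[OF life pos, of t] that unfolding at[OF that] by simp_all
  have v': "x' 0 < 0" using v x'0 by simp
  note law = curve_time_law[OF k A(2) r x0 v' pos d cxx energy a0 ak, folded b, folded t0]
  show thesis
    by (rule that[OF law(1) a0 law(2-6) x0 x'0 cxx d(1) law(7-9)])
qed

text \<open>Curves with different initial radii are rescaled copies of one even profile, so that
  \<^term>\<open>X t r\<close> is expressed through the single curve starting at \<^term>\<open>R\<close>.\<close>

lemma flow_derivative:
  fixes X :: "real \<Rightarrow> real \<Rightarrow> real" and a b T :: "real \<Rightarrow> real" and x' :: real
  assumes k: "0 < k"
    and law: "eventually (\<lambda>r. 0 < a r \<and> 0 < b r \<and>
      (\<forall>t\<ge>0. a r \<le> X t r \<and> prof_time k (X t r / a r) = b r * \<bar>t - T r\<bar>)) (nhds R)"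
    and da: "(a has_real_derivative a') (at R)"
    and db: "(b has_real_derivative b') (at R)"
    and dT: "(T has_real_derivative T') (at R)"
    and dx: "((\<lambda>t. X t R) has_real_derivative x') (at t)"
    and t: "0 < t"
  shows "((\<lambda>r. X t r) has_real_derivative
    a' / a R * X t R + x' * (b' / b R * (t - T R) - T')) (at R)"
proof -
  \<comment> \<open>The time at which the curve from \<open>R\<close> has the phase that the curve
    from \<open>r\<close> has at time \<open>t\<close>:
    \<open>b R * (s r - T R) = b r * (t - T r)\<close>.\<close>
  define s where "s r = T R + b r / b R * (t - T r)" for r
  have lawR: "0 < a R" "0 < b R"
    "\<And>t. 0 \<le> t \<Longrightarrow> a R \<le> X t R \<and> prof_time k (X t R / a R) = b R * \<bar>t - T R\<bar>"
    using eventually_nhds_x_imp_x[OF law] by auto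
  have sR: "s R = t" using lawR by (simp add: s_def)
  have ds: "(s has_real_derivative b' / b R * (t - T R) - T') (at R)"
    unfolding s_def using lawR db dT
    by (auto intro!: derivative_eq_intros simp: field_simps)
  \<comment> \<open>The time law holds only for nonnegative times; since \<open>s R = t > 0\<close>,
    continuity keeps \<open>s r\<close> in that range.\<close>
  have "eventually (\<lambda>r. 0 < s r) (nhds R)"
    using DERIV_isCont[OF ds] sR t
    by (auto simp: isCont_def tendsto_at_iff_tendsto_nhds intro: order_tendstoD(1))
  then have "eventually (\<lambda>r. a r * (X (s r) R / a R) = X t r) (nhds R)"
    using law
  proof eventually_elim
    case (elim r)
    have s0: "0 \<le> s r" using elim(1) by simp
    have r: "0 < a r" "0 < b r" "a r \<le> X t r" "prof_time k (X t r / a r) = b r * \<bar>t - T r\<bar>"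
      using elim(2) t by auto
    have "prof_time k (X (s r) R / a R) = b R * \<bar>s r - T R\<bar>" using lawR(3)[OF s0] by blast
    also have "\<dots> = \<bar>b R * (s r - T R)\<bar>" using lawR(2) by (simp add: abs_mult)
    also have "b R * (s r - T R) = b r * (t - T r)" using lawR(2) by (simp add: s_def)
    also have "\<bar>\<dots>\<bar> = prof_time k (X t r / a r)" using r by (simp add: abs_mult)
    finally have "prof_time k (X (s r) R / a R) = prof_time k (X t r / a r)" .
    moreover have "a R \<le> X (s r) R" using lawR(3)[OF s0] by blast
    then have "1 \<le> X (s r) R / a R" using lawR(1) by simp
    moreover have "1 \<le> X t r / a r" using r(1,3) by simp
    ultimately have "X (s r) R / a R = X t r / a r" 
      using prof_time_inject[OF k] by blast
    then show ?case using r by simp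
  qed
  moreover have "((\<lambda>r. a r * (X (s r) R / a R)) has_real_derivative
      a' * (X (s R) R / a R) + x' * (b' / b R * (t - T R) - T') / a R * a R) (at R)"
    using dx sR by (intro DERIV_mult[OF da DERIV_cdivide] DERIV_chain2[OF _ ds]) simp
  ultimately have "((\<lambda>r. X t r) has_real_derivative
      a' * (X (s R) R / a R) + x' * (b' / b R * (t - T R) - T') / a R * a R) (at R)"
    using DERIV_cong_ev[OF refl _ refl] by fast
  then show ?thesis using sR lawR(1) by simp
qed

text \<open>With \<^term>\<open>z = x t / a\<close>, this is the quotient of \<^term>\<open>\<Gamma>\<close> by the speed of
  the curve, up to the additive term \<^term>\<open>sgn (t - T) * T'\<close>.\<close>

definition spread :: "nat \<Rightarrow> real \<Rightarrow> real \<Rightarrow> real \<Rightarrow> real \<Rightarrow> real \<Rightarrow> real" where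
  "spread k a b a' b' z = a' / (a * b) * (z * prof k z) + b' / b\<^sup>2 * prof_time k z"

text \<open>Multiplied by the positive factor \<open>prof\<close>, the value
  \<open>\<Gamma> t\<close> has the sign of \<open>spread\<close> minus
  \<open>sgn (t - T) * T'\<close>. After \<open>T\<close> the rescaled position sweeps
  \<open>(1, \<infinity>)\<close>, between 0 and \<open>T\<close> it sweeps
  \<open>(1, R / a)\<close>, and at \<open>T\<close> itself \<open>\<Gamma>\<close> equals
  \<open>a'\<close>.\<close>

lemma breakdown_iff_spread:
  fixes x x' :: "real \<Rightarrow> real" and a b a' b' T T' :: real
  assumes k: "0 < k" and ab: "0 < a" "0 < b" and R: "a < R" and T: "0 < T" "x T = a" "x' T = 0"
    and x0: "x 0 = R"
    and cx: "continuous_on {0..} x" "continuous_on {0..} x'"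
    and ge: "\<And>t. 0 \<le> t \<Longrightarrow> a \<le> x t"
    and law: "\<And>t. 0 \<le> t \<Longrightarrow> prof_time k (x t / a) = b * \<bar>t - T\<bar>"
    and speed: "\<And>t. 0 \<le> t \<Longrightarrow> t \<noteq> T \<Longrightarrow> a < x t \<and> x' t * prof k (x t / a) = sgn (t - T) * (a * b)"
  defines "\<Gamma> t \<equiv> a' / a * x t + x' t * (b' / b * (t - T) - T')"
  assumes \<Gamma>0: "\<Gamma> 0 = 1"
  shows "(\<exists>t>0. \<Gamma> t = 0) \<longleftrightarrow> a' \<le> 0 \<or> (\<exists>z>1. spread k a b a' b' z \<le> T') \<or>
    (\<exists>z>1. z < R / a \<and> spread k a b a' b' z \<le> - T')"
proof -
  let ?P = "spread k a b a' b'"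
  have cont: "continuous_on {s..t} \<Gamma>" if "0 \<le> s" for s t
    unfolding \<Gamma>_def using that
    by (intro continuous_intros continuous_on_subset[OF cx(1)] continuous_on_subset[OF cx(2)]) auto
  have \<Gamma>T: "\<Gamma> T = a'" using T ab by (simp add: \<Gamma>_def)
  have key: "prof k (x t / a) * \<Gamma> t = a * b * (?P (x t / a) - sgn (t - T) * T')"
    if t: "0 \<le> t" "t \<noteq> T" for t
  proof -
    let ?z = "x t / a" and ?\<sigma> = "sgn (t - T)"
    have "b * (t - T) = ?\<sigma> * prof_time k ?z"
      using law[OF t(1)] t(2) by (simp add: sgn_mult_abs mult.left_commute)
    then have \<tau>: "t - T = ?\<sigma> * prof_time k ?z / b" using ab by (simp add: field_simps)
    have "prof k ?z * \<Gamma> t = a' * (?z * prof k ?z) + x' t * prof k ?z * (b' / b * (t - T) - T')"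
      by (simp add: \<Gamma>_def algebra_simps)
    also have "\<dots> = a' * (?z * prof k ?z) + ?\<sigma> * (a * b) * (b' / b * (t - T) - T')"
      using speed[OF t] by simp
    also have "\<dots> = a' * (?z * prof k ?z) + (?\<sigma> * ?\<sigma>) * a * b' * prof_time k ?z / b - a * b * (?\<sigma> * T')"
      by (subst \<tau>) (use ab in \<open>simp add: field_simps\<close>)
    also have "?\<sigma> * ?\<sigma> = 1" using t(2) by (simp add: sgn_if)
    also have "a' * (?z * prof k ?z) + 1 * a * b' * prof_time k ?z / b - a * b * (?\<sigma> * T')
        = a * b * (?P ?z - ?\<sigma> * T')"
      using ab by (simp add: spread_def field_simps power2_eq_square)
    finally show ?thesis .
  qed
  have sign: "\<Gamma> t \<le> 0 \<longleftrightarrow> ?P (x t / a) \<le> sgn (t - T) * T'" if t: "0 \<le> t" "t \<noteq> T" for t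
  proof -
    have "0 < prof k (x t / a)" using speed[OF t] ab by (intro prof_pos[OF k]) auto
    then have "\<Gamma> t \<le> 0 \<longleftrightarrow> prof k (x t / a) * \<Gamma> t \<le> 0" by (simp add: mult_le_0_iff)
    also have "\<dots> \<longleftrightarrow> ?P (x t / a) - sgn (t - T) * T' \<le> 0"
      unfolding key[OF t] using ab mult_pos_pos[OF ab] by (simp add: mult_le_0_iff)
    finally show ?thesis by simp
  qed
  have reach: "x t / a = z" if "1 < z" "0 \<le> t" "b * \<bar>t - T\<bar> = prof_time k z" for t z
  proof -
    have "1 \<le> x t / a" using ge[OF that(2)] ab by simp
    then show ?thesis using prof_time_inject[OF k, of "x t / a" z] law[OF that(2)] that by simp
  qed
  have TG: "prof_time k (R / a) = b * T" using law[of 0] x0 T by simp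
  show ?thesis
  proof
    assume "\<exists>t>0. \<Gamma> t = 0"
    then obtain t where t: "0 < t" "\<Gamma> t = 0" by blast
    show "a' \<le> 0 \<or> (\<exists>z>1. ?P z \<le> T') \<or> (\<exists>z>1. z < R / a \<and> ?P z \<le> - T')"
    proof (cases t T rule: linorder_cases)
      case less
      then have "?P (x t / a) \<le> - T'" using sign[of t] t by simp
      moreover have "1 < x t / a" using speed[of t] less t ab by simp
      moreover have "x t / a < R / a"
      proof (rule ccontr)
        assume "\<not> x t / a < R / a"
        then have "R / a = x t / a \<or> R / a < x t / a" by linarith
        then have "prof_time k (R / a) \<le> prof_time k (x t / a)"
          using prof_time_strict_mono[OF k, of "R / a" "x t / a"] R ab by (elim disjE) simp_all
        then have "b * T \<le> b * (T - t)" using TG law[of t] t less by simp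
        then show False using ab t by simp
      qed
      ultimately show ?thesis by blast
    next
      case equal
      then show ?thesis using t \<Gamma>T by simp
    next
      case greater
      then have "?P (x t / a) \<le> T'" using sign[of t] t by simp
      moreover have "1 < x t / a" using speed[of t] greater t ab by simp
      ultimately show ?thesis by blast
    qed
  next
    assume r: "a' \<le> 0 \<or> (\<exists>z>1. ?P z \<le> T') \<or> (\<exists>z>1. z < R / a \<and> ?P z \<le> - T')"
    \<comment> \<open>Because \<open>\<Gamma> 0 = 1\<close>, a nonpositive value anywhere produces a
      zero by the intermediate value theorem, and that zero is not at time 0.\<close>
    have early: "\<exists>t>0. \<Gamma> t = 0" if "\<Gamma> t \<le> 0" "0 \<le> t" for t
    proof -
      have "\<exists>s\<ge>0. s \<le> t \<and> \<Gamma> s = 0" using that \<Gamma>0 cont[of 0 t] by (intro IVT2') auto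
      then show ?thesis using \<Gamma>0 by (metis less_eq_real_def zero_neq_one)
    qed
    consider "a' \<le> 0" | z where "1 < z" "?P z \<le> T'" | z where "1 < z" "z < R / a" "?P z \<le> - T'"
      using r by blast
    then show "\<exists>t>0. \<Gamma> t = 0"
    proof cases
      case 1
      then show ?thesis using early[of T] \<Gamma>T T by simp
    next
      case 2
      define t where "t = T + prof_time k z / b"
      have t: "T < t" using prof_time_pos[OF k 2(1)] ab by (simp add: t_def)
      have "x t / a = z" using 2 t T ab prof_time_pos[OF k 2(1)] by (intro reach) (auto simp: t_def)
      then show ?thesis using early[of t] sign[of t] 2 t T by simp
    next
      case 3
      \<comment> \<open>The inward passage through \<open>z\<close>; the assumption
        \<open>z < R / a\<close> makes this time positive.\<close>
      define t where "t = T - prof_time k z / b"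
      have t: "t < T" using prof_time_pos[OF k 3(1)] ab by (simp add: t_def)
      have "prof_time k z < b * T" unfolding TG[symmetric]
        using 3 by (intro prof_time_strict_mono[OF k]) auto
      then have t0: "0 < t" using ab by (simp add: t_def field_simps)
      have "x t / a = z" using 3 t t0 ab prof_time_pos[OF k 3(1)] by (intro reach) (auto simp: t_def)
      then show ?thesis using early[of t] sign[of t] 3 t t0 by simp
    qed
  qed
qed

section \<open>Derivatives of the length scale, the profile and the spread\<close>

lemma has_real_derivative_length_scale:
  fixes A C :: "real \<Rightarrow> real"
  assumes k: "0 < k" and dA: "(A has_real_derivative A') (at R)" and dC: "(C has_real_derivative C') (at R)"
    and pos: "0 < A R" "0 < C R"
  defines "a r \<equiv> (A r / C r) powr (1 / real k)"
  shows "(a has_real_derivative a R / real k * (A' / A R - C' / C R)) (at R)"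
proof -
  have "((\<lambda>r. A r / C r) has_real_derivative (A' * C R - A R * C') / (C R * C R)) (at R)"
    using DERIV_divide[OF dA dC] pos by simp
  from DERIV_chain2[OF has_real_derivative_powr this, of "1 / real k"]
  have "(a has_real_derivative 1 / real k * (A R / C R) powr (1 / real k - 1) *
      ((A' * C R - A R * C') / (C R * C R))) (at R)"
    using pos unfolding a_def by simp
  moreover have "(A R / C R) powr (1 / real k - 1) = a R / (A R / C R)"
    using pos by (simp add: a_def powr_diff)
  moreover have "1 / real k * (a R / (A R / C R)) * ((A' * C R - A R * C') / (C R * C R))
      = a R / real k * (A' / A R - C' / C R)"
    using pos k by (simp add: field_simps)
  ultimately show ?thesis by simp
qed

lemma prof_deriv:
  assumes k: "0 < k" and z: "1 < z"
  shows "(prof k has_real_derivative - (real k * prof k z ^ 3 / (2 * z ^ (k + 1)))) (at z)"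
proof -
  have p: "0 < 1 - 1 / z ^ k" using prof_radicand[OF k z] by simp
  define q where "q = sqrt (1 - 1 / z ^ k)"
  have q: "0 < q" using p by (simp add: q_def)
  have pw: "z ^ k * z ^ k = z ^ (k + 1) * z ^ (k - 1)" using k by (cases k) auto
  have "((\<lambda>u. 1 / u ^ k) has_real_derivative - (real k / z ^ (k + 1))) (at z)"
  proof -
    have "((\<lambda>u. 1 / u ^ k) has_real_derivative - (real k * z ^ (k - 1) / (z ^ k * z ^ k))) (at z)"
      using z by (auto intro!: derivative_eq_intros)
    also have "real k * z ^ (k - 1) / (z ^ k * z ^ k) = real k / z ^ (k + 1)"
      unfolding pw using z by simp
    finally show ?thesis .
  qed
  then have "((\<lambda>u. 1 - 1 / u ^ k) has_real_derivative real k / z ^ (k + 1)) (at z)"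
    using DERIV_diff[OF DERIV_const [of 1]] by fastforce
  from DERIV_chain2[OF DERIV_real_sqrt[OF p] this]
  have "((\<lambda>u. sqrt (1 - 1 / u ^ k)) has_real_derivative inverse q / 2 * (real k / z ^ (k + 1))) (at z)"
    by (simp add: q_def)
  moreover have "sqrt (1 - 1 / z ^ k) \<noteq> 0" using q unfolding q_def by linarith
  ultimately
  have "((\<lambda>u. inverse (sqrt (1 - 1 / u ^ k))) has_real_derivative
      - (inverse q * (inverse q / 2 * (real k / z ^ (k + 1))) * inverse q)) (at z)"
    unfolding q_def by (rule DERIV_inverse')
  then show ?thesis
    using q by (simp add: prof_def [abs_def] flip: q_def)
      (simp add: field_simps power3_eq_cube)
qed

text \<open>The hypotheses are the relations between \<open>(A, C)\<close> and \<open>(a, b)\<close>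
  together with their derivatives in the radius. With \<open>q = sqrt (1 - 1 / z ^ k)\<close> one
  has \<open>C - A / y ^ k = (a * b * q)\<^sup>2\<close>, and the claim becomes a rational identity
  in \<open>q\<close>.\<close>

lemma spread_deriv:
  fixes a b a' b' A A' C C' :: real
  assumes k: "0 < k" and ab: "0 < a" "0 < b"
    and C: "C = (a * b)\<^sup>2" and A: "A = a ^ k * C"
    and C': "C' = 2 * a * b * (a' * b + a * b')" and A': "A' = A * (real k * a' / a + C' / C)"
    and y: "a < y"
  shows "((\<lambda>y. spread k a b a' b' (y / a)) has_real_derivative
    (C' - A' / y ^ k) / (2 * (C - A / y ^ k) powr (3 / 2))) (at y)"
proof -
  define z where "z = y / a"
  define q where "q = sqrt (1 - 1 / z ^ k)"
  have z: "1 < z" using y ab by (simp add: z_def)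
  have q: "0 < q" using prof_radicand[OF k z] by (simp add: q_def)
  have q2: "q\<^sup>2 = 1 - 1 / z ^ k" using prof_radicand[OF k z] by (simp add: q_def)
  have pq: "prof k z = 1 / q" by (simp add: prof_def q_def)
  have y_z: "y = a * z" using ab by (simp add: z_def)
  have "(spread k a b a' b' has_real_derivative
      a' / (a * b) * (1 / q - (1 - q\<^sup>2) * real k / (2 * q ^ 3)) + b' / b\<^sup>2 * (1 / q)) (at z)"
    unfolding spread_def [abs_def] q2
    by (rule derivative_eq_intros prof_deriv[OF k z] prof_time_deriv[OF k z] refl)+
      (use z q in \<open>simp add: pq field_simps\<close>)
  then have "((\<lambda>y. spread k a b a' b' (y / a)) has_real_derivative
      (a' / (a * b) * (1 / q - (1 - q\<^sup>2) * real k / (2 * q ^ 3)) + b' / b\<^sup>2 * (1 / q)) * (1 / a)) (at y)"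
    unfolding z_def using ab by (intro DERIV_chain2[where f = "spread k a b a' b'"]) 
      (auto intro!: derivative_eq_intros)
  moreover have "(C - A / y ^ k) powr (3 / 2) = (a * b * q) ^ 3"
  proof -
    have "C - A / y ^ k = C * (1 - 1 / z ^ k)"
      using ab z by (simp add: A y_z power_mult_distrib algebra_simps)
    also have "\<dots> = (a * b * q)\<^sup>2"
      by (simp add: C q2 power_mult_distrib)
    also have "\<dots> = (a * b * q) powr 2"
      using ab q by (simp add: powr_numeral)
    finally have "(C - A / y ^ k) powr (3 / 2) = (a * b * q) powr 3"
      by (simp add: powr_powr)
    then show ?thesis using ab q by (simp add: powr_numeral)
  qed
  moreover have "C' - A' / y ^ k = 2 * a * b * (a' * b + a * b') * q\<^sup>2 - real k * a' * a * b\<^sup>2 * (1 - q\<^sup>2)"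
  proof -
    have "A' / y ^ k = (real k * a' * a * b\<^sup>2 + C') * (1 / z ^ k)"
      using ab z by (simp add: A' A y_z C power_mult_distrib field_simps power2_eq_square)
    also have "1 / z ^ k = 1 - q\<^sup>2" using q2 by simp
    finally show ?thesis by (simp add: C' algebra_simps)
  qed
  moreover have "(a' / (a * b) * (1 / q - (1 - q\<^sup>2) * real k / (2 * q ^ 3)) + b' / b\<^sup>2 * (1 / q)) * (1 / a)
      = (2 * a * b * (a' * b + a * b') * q\<^sup>2 - real k * a' * a * b\<^sup>2 * (1 - q\<^sup>2)) / (2 * (a * b * q) ^ 3)"
    using ab q by (simp add: field_simps power2_eq_square power3_eq_cube)
  ultimately show ?thesis by simp
qed

section \<open>The sign analysis\<close>

lemma antimono_bounded_limit:
  fixes h :: "real \<Rightarrow> real"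
  assumes anti: "\<And>s t. R \<le> s \<Longrightarrow> s \<le> t \<Longrightarrow> h t \<le> h s" and bd: "\<And>t. R \<le> t \<Longrightarrow> B \<le> h t"
  obtains L where "(h \<longlongrightarrow> L) at_top" "B \<le> L" "\<And>t. R \<le> t \<Longrightarrow> L \<le> h t"
proof -
  define L where "L = Inf (h ` {R..})"
  have bdd: "bdd_below (h ` {R..})" using bd by (auto intro!: bdd_belowI[of _ B])
  have le: "L \<le> h t" if "R \<le> t" for t
    unfolding L_def using that by (intro cInf_lower bdd) auto
  have "B \<le> L" unfolding L_def using bd by (intro cInf_greatest) auto
  moreover have "(h \<longlongrightarrow> L) at_top"
  proof (rule order_tendstoI)
    fix l assume "l < L"
    then show "eventually (\<lambda>t. l < h t) at_top"
      using le by (intro eventually_at_top_linorderI[of R]) (meson less_le_trans)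
  next
    fix u assume "L < u"
    then obtain s where "R \<le> s" "h s < u"
      unfolding L_def using cInf_less_iff[OF _ bdd] by auto
    then show "eventually (\<lambda>t. h t < u) at_top"
      using anti by (intro eventually_at_top_linorderI[of s]) (meson le_less_trans)
  qed
  ultimately show thesis using that le by blast
qed

text \<open>The one-variable problem that remains: \<open>h\<close> is \<open>spread\<close> in the
  unscaled position plus the derivative of the turning time, and \<open>w\<close> is the initial
  speed. The assumption \<open>sub\<close> is the failure of condition (5); for
  \<open>C' > 0\<close> it places the critical point of \<open>h\<close> to the right of
  \<open>a\<close>.\<close>

locale spread_profile =
  fixes k :: nat and a R A A' C C' w :: real and h :: "real \<Rightarrow> real"
  assumes k: "0 < k" and a: "0 < a" "a ^ k = A / C" and aR: "a < R" and AC: "0 < A" "0 < C"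
    and A': "0 \<le> A'" and w: "0 < w" and hR: "h R = 1 / w"
    and h_deriv: "\<And>y. a < y \<Longrightarrow>
      (h has_real_derivative (C' - A' / y ^ k) / (2 * (C - A / y ^ k) powr (3 / 2))) (at y)"
    and sub: "C' < A' * C / A"
begin

lemma denominator_pos: "a < y \<Longrightarrow> 0 < C - A / y ^ k"
proof -
  assume y: "a < y"
  then have "a ^ k < y ^ k" using a k by (intro power_strict_mono) auto
  then have "A / C < y ^ k" using a by simp
  then show ?thesis using AC a y by (simp add: field_simps)
qed

lemma h_cont: "a < y \<Longrightarrow> continuous_on {y..z} h"
  by (rule DERIV_continuous_on[OF has_field_derivative_at_within[OF h_deriv]]) auto

lemma h_decreasing:
  assumes "a < y" "y < z" "\<And>s. y < s \<Longrightarrow> s < z \<Longrightarrow> C' < A' / s ^ k"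
  shows "h z < h y"
proof (rule DERIV_neg_imp_decreasing_open[OF assms(2) _ h_cont[OF assms(1)]])
  fix s assume s: "y < s" "s < z"
  show "\<exists>d. (h has_real_derivative d) (at s) \<and> d < 0"
    using h_deriv[of s] denominator_pos[of s] assms s
    by (intro exI conjI) (auto intro!: divide_neg_pos)
qed

lemma h_increasing:
  assumes "a < y" "y < z" "\<And>s. y < s \<Longrightarrow> s < z \<Longrightarrow> A' / s ^ k < C'"
  shows "h y < h z"
proof (rule DERIV_pos_imp_increasing_open[OF assms(2) _ h_cont[OF assms(1)]])
  fix s assume s: "y < s" "s < z"
  show "\<exists>d. (h has_real_derivative d) (at s) \<and> 0 < d"
    using h_deriv[of s] denominator_pos[of s] assms s
    by (intro exI conjI) (auto intro!: divide_pos_pos)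
qed

text \<open>Since \<open>A' \<ge> 0\<close> and the denominator is at most
  \<open>2 * C powr (3 / 2)\<close>, the slope of \<open>h\<close> beyond \<open>R\<close> is at
  most the negative constant \<open>-m\<close>.\<close>

lemma h_unbounded_below:
  assumes "C' < 0" shows "\<exists>y>a. h y \<le> B"
proof -
  define m where "m = - C' / (2 * C powr (3 / 2))"
  have m: "0 < m" using assms AC by (simp add: m_def divide_neg_pos)
  define y where "y = R + (\<bar>h R\<bar> + \<bar>B\<bar> + 1) / m"
  have y: "R < y" using m by (simp add: y_def add_nonneg_pos)
  have "h y + m * y \<le> h R + m * R"
  proof (rule DERIV_nonpos_imp_decreasing_open[where f = "\<lambda>y. h y + m * y"])
    show "continuous_on {R..y} (\<lambda>y. h y + m * y)"
      by (intro continuous_intros h_cont aR)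
    fix s assume s: "R < s" "s < y"
    let ?d = "(C' - A' / s ^ k) / (2 * (C - A / s ^ k) powr (3 / 2))"
    have s0: "0 < s" using s a aR by simp
    have D: "0 < (C - A / s ^ k) powr (3 / 2)" using denominator_pos[of s] s aR by simp
    have "(C - A / s ^ k) powr (3 / 2) \<le> C powr (3 / 2)"
      using denominator_pos[of s] s s0 aR AC by (intro powr_mono2) auto
    then have "C' / (2 * (C - A / s ^ k) powr (3 / 2)) \<le> C' / (2 * C powr (3 / 2))"
      using assms D AC by (intro divide_left_mono_neg) auto
    moreover have "?d \<le> C' / (2 * (C - A / s ^ k) powr (3 / 2))"
      using D A' s0 by (intro divide_right_mono) auto
    ultimately have "?d + m \<le> 0" by (simp add: m_def)
    moreover have "((\<lambda>y. h y + m * y) has_real_derivative ?d + m) (at s)"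
      using h_deriv[of s] s aR by (auto intro!: derivative_eq_intros)
    ultimately show "\<exists>d. ((\<lambda>y. h y + m * y) has_real_derivative d) (at s) \<and> d \<le> 0" by blast
  qed (use y in simp)
  moreover have "m * y = m * R + \<bar>h R\<bar> + \<bar>B\<bar> + 1" using m by (simp add: y_def field_simps)
  ultimately have "h y \<le> B" by linarith
  then show ?thesis using y aR by (intro exI[of _ y]) auto
qed

text \<open>For \<open>C' = 0\<close> the function \<open>h\<close> decreases strictly, and the left
  side of the inequality is its limit at infinity, \<open>-\<infinity>\<close> if the integral
  diverges. The limit is not attained, so a value \<open>\<le> B\<close> exists exactly if the limit
  is \<open>< B\<close>; hence the strict inequality in condition (2).\<close>

lemma critical_condition:
  assumes C'0: "C' = 0"
  shows "(\<exists>y>a. h y \<le> B) \<longleftrightarrow>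
    ereal (1 / w) - ereal (1 / 2) * enn2ereal (\<integral>\<^sup>+ y\<in>{R..}.
      ennreal ((A' / y ^ k) / (C - A / y ^ k) powr (3 / 2)) \<partial>lborel) < ereal B"
proof -
  define f where "f y = (A' / y ^ k) / (C - A / y ^ k) powr (3 / 2)" for y
  define I where "I = (\<integral>\<^sup>+ y\<in>{R..}. ennreal (f y) \<partial>lborel)"
  have A'pos: "0 < A'" using sub C'0 A' AC by (cases "A' = 0") auto
  have dec: "h z < h y" if "a < y" "y < z" for y z
    using that a A'pos C'0 by (intro h_decreasing) auto
  have meas [measurable]: "f \<in> borel_measurable borel" unfolding f_def by measurable
  have f0: "0 \<le> f y" if "a < y" for y
    using that a A' by (simp add: f_def)
  have F: "((\<lambda>y. - 2 * h y) has_real_derivative f y) (at y)" if "a < y" for y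
  proof -
    have "((\<lambda>y. - 2 * h y) has_real_derivative
        - 2 * ((C' - A' / y ^ k) / (2 * (C - A / y ^ k) powr (3 / 2)))) (at y)"
      by (intro DERIV_cmult h_deriv that)
    moreover have "- 2 * ((C' - A' / y ^ k) / (2 * (C - A / y ^ k) powr (3 / 2))) = f y"
      by (simp add: f_def C'0)
    ultimately show ?thesis by simp
  qed
  have "(\<exists>y>a. h y \<le> B) \<longleftrightarrow> ereal (1 / w) - ereal (1 / 2) * enn2ereal I < ereal B"
  proof
    assume "\<exists>y>a. h y \<le> B"
    then obtain y where y: "a < y" "h y \<le> B" by blast
    \<comment> \<open>A point strictly beyond both \<open>y\<close> and \<open>R\<close>, so that
      \<open>h Y < B\<close> holds strictly and the integral over \<open>{R..Y}\<close> bounds the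
      full one from below.\<close>
    define Y where "Y = max y R + 1"
    have "y < Y" "R < Y" by (auto simp: Y_def)
    then have Y: "R \<le> Y" "h Y < B" "h Y < h R"
      using dec[of y Y] dec[of R Y] y aR \<open>y < Y\<close> \<open>R < Y\<close> by auto
    have "ennreal (2 / w - 2 * h Y) = (\<integral>\<^sup>+ y\<in>{R..Y}. ennreal (f y) \<partial>lborel)"
      using aR Y nn_integral_FTC_Icc[OF meas F f0, of R Y] by (simp add: hR)
    also have "\<dots> \<le> I"
      unfolding I_def by (intro nn_integral_mono) (auto simp: indicator_def)
    finally have I: "ennreal (2 / w - 2 * h Y) \<le> I" .
    show "ereal (1 / w) - ereal (1 / 2) * enn2ereal I < ereal B"
    proof (cases I rule: ennreal_cases)
      case (real i)
      then have "2 / w - 2 * h Y \<le> i" using I by simp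
      then show ?thesis using Y real by simp
    next
      case top
      then show ?thesis by simp
    qed
  next
    assume less: "ereal (1 / w) - ereal (1 / 2) * enn2ereal I < ereal B"
    show "\<exists>y>a. h y \<le> B"
    proof (rule ccontr)
      assume "\<not> (\<exists>y>a. h y \<le> B)"
      then have B: "B \<le> h y" if "R \<le> y" for y using aR that by (meson less_le_trans linear)
      have anti: "h t \<le> h s" if "R \<le> s" "s \<le> t" for s t
        using dec[of s t] that aR by (cases "s = t") auto
      \<comment> \<open>If \<open>h\<close> stayed above \<open>B\<close>, it would have a finite
        limit, and the integral could be evaluated exactly as \<open>2 * (h R - L)\<close>.\<close>
      obtain L where L: "(h \<longlongrightarrow> L) at_top" "B \<le> L" "L \<le> h R"
        using antimono_bounded_limit[of R h B, OF anti B] by blast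
      have "I = ennreal (- 2 * L - (- 2 * h R))"
        unfolding I_def
        by (rule nn_integral_FTC_atLeast[where F = "\<lambda>y. - 2 * h y"])
          (use aR F f0 L in \<open>auto intro!: tendsto_intros\<close>)
      then have "enn2ereal I = ereal (2 * h R - 2 * L)" using L by (simp add: enn2ereal_ennreal)
      moreover have "1 / w - 1 / 2 * (2 * h R - 2 * L) = L" by (simp add: hR diff_divide_distrib)
      ultimately show False using less L(2) by simp
    qed
  qed
  then show ?thesis by (simp add: I_def f_def)
qed

text \<open>The interval integral is oriented, so the formula also covers \<open>y < R\<close>, the
  situation of condition (4).\<close>

lemma h_integral:
  assumes y: "a < y"
  shows "1 / w + 1 / 2 * (LBINT y=R..y. (C' - A' / y ^ k) / (C - A / y ^ k) powr (3 / 2)) = h y"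
proof -
  have "(LBINT y=R..y. (C' - A' / y ^ k) / (C - A / y ^ k) powr (3 / 2)) = 2 * h y - 2 * h R"
  proof (rule interval_integral_FTC_finite)
    have "s ^ k \<noteq> 0" "C - A / s ^ k \<noteq> 0" "(C - A / s ^ k) powr (3 / 2) \<noteq> 0"
      if "s \<in> {min R y..max R y}" for s
    proof -
      have "a < s" using that y aR by auto
      then show "s ^ k \<noteq> 0" "C - A / s ^ k \<noteq> 0" "(C - A / s ^ k) powr (3 / 2) \<noteq> 0"
        using denominator_pos[of s] a by auto
    qed
    then show "continuous_on {min R y..max R y} (\<lambda>y. (C' - A' / y ^ k) / (C - A / y ^ k) powr (3 / 2))"
      by (intro continuous_intros) blast+
    fix s assume "min R y \<le> s" "s \<le> max R y"
    then have s: "a < s" using y aR by auto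
    have "((\<lambda>y. 2 * h y) has_real_derivative
        2 * ((C' - A' / s ^ k) / (2 * (C - A / s ^ k) powr (3 / 2)))) (at s)"
      by (intro DERIV_cmult h_deriv s)
    moreover have "2 * (p / (2 * q)) = p / q" for p q :: real by simp
    ultimately show "((\<lambda>y. 2 * h y) has_vector_derivative (C' - A' / s ^ k) / (C - A / s ^ k) powr (3 / 2))
        (at s within {min R y..max R y})"
      by (metis has_real_derivative_iff_has_vector_derivative has_vector_derivative_at_within)
  qed
  then show ?thesis by (simp add: hR diff_divide_distrib)
qed

text \<open>The slope of \<open>h\<close> has the sign of \<open>C' - A' / y ^ k\<close>. For
  \<open>C' > 0\<close> the global minimum is at \<open>y1\<close>; whether \<open>y1\<close> lies
  left of \<open>R\<close> decides if the inward passage can contribute a zero.\<close>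

lemma breakdown_cases:
  fixes T :: real
  defines "y1 \<equiv> (A' / C') powr (1 / real k)"
  defines "J \<equiv> (LBINT y=R..y1. (C' - A' / y ^ k) / (C - A / y ^ k) powr (3 / 2))"
  shows "(\<exists>y>a. h y \<le> 2 * T) \<or> (\<exists>y>a. y < R \<and> h y \<le> 0) \<longleftrightarrow>
    C' < 0 \<or>
    (C' = 0 \<and> ereal (1 / w) - ereal (1 / 2) * enn2ereal (\<integral>\<^sup>+ y\<in>{R..}.
      ennreal ((A' / y ^ k) / (C - A / y ^ k) powr (3 / 2)) \<partial>lborel) < ereal (2 * T)) \<or>
    (0 < C' \<and> C' \<le> A' / R ^ k \<and> 1 / w + 1 / 2 * J \<le> 2 * T) \<or>
    (A' / R ^ k < C' \<and> 1 / w + 1 / 2 * J \<le> max 0 (2 * T))"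
proof -
  have "0 < h R" using hR w by simp
  show ?thesis
  proof (cases C' "0 :: real" rule: linorder_cases)
    case less
    then show ?thesis using h_unbounded_below by blast
  next
    case equal
    have A'pos: "0 < A'" using sub equal A' AC by (cases "A' = 0") auto
    have "h R < h y" if "a < y" "y < R" for y
      using that a A'pos equal by (intro h_decreasing) auto
    then have "\<not> (\<exists>y>a. y < R \<and> h y \<le> 0)" using \<open>0 < h R\<close> by (meson less_trans not_le)
    moreover have "\<not> A' / R ^ k < C'" "\<not> C' < 0" "\<not> 0 < C'" using equal A' aR a by (simp_all add: not_less)
    ultimately show ?thesis using critical_condition[OF equal, of "2 * T"] equal by blast
  next
    case greater
    have A'pos: "0 < A'" using sub greater A' AC by (cases "A' = 0") auto
    have y1: "0 < y1" "y1 ^ k = A' / C'"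
    proof -
      show "0 < y1" using A'pos greater by (simp add: y1_def)
      then have "y1 ^ k = y1 powr real k" by (rule powr_realpow [symmetric])
      also have "\<dots> = A' / C'" using A'pos greater k by (simp add: y1_def powr_powr)
      finally show "y1 ^ k = A' / C'" .
    qed
    have crit: "s < y1 \<longleftrightarrow> C' < A' / s ^ k" "y1 < s \<longleftrightarrow> A' / s ^ k < C'" if "0 < s" for s
    proof -
      have "s ^ k \<le> y1 ^ k \<longleftrightarrow> s \<le> y1" "y1 ^ k \<le> s ^ k \<longleftrightarrow> y1 \<le> s"
        using y1(1) that k by simp_all
      then have "s < y1 \<longleftrightarrow> s ^ k < y1 ^ k" "y1 < s \<longleftrightarrow> y1 ^ k < s ^ k"
        by linarith+
      then show "s < y1 \<longleftrightarrow> C' < A' / s ^ k" "y1 < s \<longleftrightarrow> A' / s ^ k < C'"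
        using y1(2) greater that by (simp_all add: field_simps)
    qed
    have "a < y1"
      using crit(1)[OF a(1)] sub a AC by (simp add: field_simps)
    have hmin: "h y1 \<le> h y" if "a < y" for y
    proof (cases y y1 rule: linorder_cases)
      case less
      have "h y1 < h y" using that less a crit(1) by (intro h_decreasing) auto
      then show ?thesis by simp
    next
      case greater
      have "h y1 < h y" using greater \<open>a < y1\<close> crit(2) y1(1) by (intro h_increasing) (auto dest: less_trans)
      then show ?thesis by simp
    qed simp
    have hJ: "1 / w + 1 / 2 * J = h y1" unfolding J_def using h_integral[OF \<open>a < y1\<close>] .
    have first: "(\<exists>y>a. h y \<le> 2 * T) \<longleftrightarrow> h y1 \<le> 2 * T"
      using hmin \<open>a < y1\<close> by (meson order_trans)
    have "0 < R" using a aR by simp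
    show ?thesis
    proof (cases "R \<le> y1")
      case True
      \<comment> \<open>With the minimum at or beyond \<open>R\<close>, the inward values exceed
        \<open>h R = 1 / w > 0\<close>, so only the outward passage counts.\<close>
      have "h R < h y" if "a < y" "y < R" for y
      proof (rule h_decreasing[OF that])
        fix s assume "y < s" "s < R"
        then show "C' < A' / s ^ k" using that a(1) True crit(1)[of s] by simp
      qed
      then have "\<not> (\<exists>y>a. y < R \<and> h y \<le> 0)" using \<open>0 < h R\<close> by (meson less_trans not_le)
      moreover have "C' \<le> A' / R ^ k" "\<not> A' / R ^ k < C'" "\<not> C' < 0" "C' \<noteq> 0"
        using crit(2)[OF \<open>0 < R\<close>] True greater by auto
      ultimately show ?thesis unfolding hJ using first greater by blast
    next
      case False
      \<comment> \<open>Now \<open>y1\<close> itself lies in \<open>(a, R)\<close>, so the bounds 0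
        and \<open>2 * T\<close> are both tested at the same minimum, which yields the
        \<open>max\<close>.\<close>
      then have "(\<exists>y>a. y < R \<and> h y \<le> 0) \<longleftrightarrow> h y1 \<le> 0"
        using hmin \<open>a < y1\<close> by (meson order_trans not_le)
      moreover have "A' / R ^ k < C'" using crit(2)[OF \<open>0 < R\<close>] False by simp
      ultimately show ?thesis using first greater hJ by (auto simp: le_max_iff_disj)
    qed
  qed
qed

end

section \<open>Vanishing mass, and the coefficient functions\<close>

text \<open>Without force the velocity is constant, so the curve is a straight line meeting 0 at
  \<open>E\<close>; left continuity extends the linear formula to \<open>E\<close> itself.\<close>

lemma free_curve_vanishes:
  assumes "0 < R" "x 0 = R" "x' 0 < 0"
    and dx: "\<And>t. in_lifespan x t \<Longrightarrow> 0 < x t \<Longrightarrow> (x has_real_derivative x' t) (at t within {0..})"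
    and dx': "\<And>t. in_lifespan x t \<Longrightarrow> 0 < x t \<Longrightarrow> (x' has_real_derivative 0) (at t within {0..})"
    and cx: "\<And>t. in_lifespan x t \<Longrightarrow> continuous (at t within {0..t}) x"
  defines "E \<equiv> R / - x' 0"
  shows "0 < E" "in_lifespan x E" "x E = 0"
proof -
  show E: "0 < E" using assms(1,3) by (simp add: E_def divide_pos_neg)
  have free: "R + x' 0 * t = x t" if t: "in_lifespan x t" "0 < x t" for t
  proof -
    have "((\<lambda>t. x t - x' 0 * t) has_real_derivative 0) (at s within {0..})"
      if "in_lifespan x s" "0 < x s" for s
      using dx[OF that] zero_derivative_on_lifespan[OF dx' that]
      by (auto intro!: derivative_eq_intros)
    from zero_derivative_on_lifespan[OF this t] show ?thesis using assms(2) by simp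
  qed
  have limit: "R + x' 0 * T = x T" if "0 < T" "in_lifespan x T" for T
  proof (rule tendsto_unique)
    show "((\<lambda>s. R + x' 0 * s) \<longlongrightarrow> x T) (at_left T)"
      by (rule in_lifespan_limit[OF cx[OF that(2)] that]) (rule free)
    show "((\<lambda>s. R + x' 0 * s) \<longlongrightarrow> R + x' 0 * T) (at_left T)"
      by (intro tendsto_intros)
  qed auto
  have "0 < x s" if "0 \<le> s" "s < E" for s
  proof (rule pos_until[OF _ DERIV_continuous[OF dx] _ that(1)])
    show "0 < x 0" using assms by simp
    fix T assume T: "0 < T" "T \<le> s" "in_lifespan x T"
    have "T < R / - x' 0" using T(2) that(2) by (simp add: E_def)
    then have "T * - x' 0 < R" using assms(3) by (subst (asm) pos_less_divide_eq) auto
    then show "0 < x T" using limit[OF T(1,3)] by (simp add: algebra_simps)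
  qed
  then show life: "in_lifespan x E" using E by (simp add: in_lifespan_def)
  show "x E = 0" using limit[OF E life] assms(3) by (simp add: E_def)
qed

section \<open>The mass function and the turning time as functions of the radius\<close>

lemma mass0_eq_integral:
  assumes "continuous_on {0..} \<rho>0" "0 \<le> r"
  shows "mass0 n \<rho>0 r = integral {0..r} (\<lambda>s. \<rho>0 s * s ^ (n - 1))"
proof -
  have "set_integrable lborel {0..r} (\<lambda>s. \<rho>0 s * s ^ (n - 1))"
    by (intro borel_integrable_atLeastAtMost' continuous_intros continuous_on_subset[OF assms(1)]) auto
  from interval_integral_eq_integral[OF assms(2) this] show ?thesis
    by (simp add: mass0_def zero_ereal_def)
qed

lemma mass0_nonneg:
  assumes "continuous_on {0..} \<rho>0" "\<And>r. 0 \<le> r \<Longrightarrow> 0 \<le> \<rho>0 r" "0 \<le> r"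
  shows "0 \<le> mass0 n \<rho>0 r"
  unfolding mass0_eq_integral[OF assms(1,3)]
  using assms
  by (intro integral_nonneg integrable_continuous_real continuous_intros continuous_on_subset[OF assms(1)]) auto

lemma mass0_deriv:
  assumes "continuous_on {0..} \<rho>0" "0 < R"
  shows "(mass0 n \<rho>0 has_real_derivative \<rho>0 R * R ^ (n - 1)) (at R)"
proof -
  let ?f = "\<lambda>s. \<rho>0 s * s ^ (n - 1)"
  have "((\<lambda>r. integral {0..r} ?f) has_real_derivative ?f R) (at R within {0..R + 1})"
    using assms(2)
    by (intro integral_has_real_derivative continuous_intros continuous_on_subset[OF assms(1)]) auto
  moreover have "at R within {0..R + 1} = at R"
    using assms(2) by (intro at_within_interior) simp
  ultimately have "((\<lambda>r. integral {0..r} ?f) has_real_derivative ?f R) (at R)" by simp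
  then show ?thesis
    by (rule has_field_derivative_transform_within_open[of _ _ _ "{0<..}"])
       (use assms in \<open>auto simp: mass0_eq_integral\<close>)
qed

text \<open>With \<open>n = k + 2\<close> the exponent \<open>n / (2 * k)\<close> splits as
  \<open>1 / k + 1 / 2\<close>, so the prefactor is \<open>a / sqrt C\<close>; the upper limit of
  integration is \<open>r / a\<close>.\<close>

lemma t_star_eq_prof_time:
  assumes k: "0 < k"
    and A: "A = A_fun lam (k + 2) \<rho>0 r" "0 < A" and C: "C = C_fun lam (k + 2) \<rho>0 v0 r" "0 < C"
    and a: "a = (A / C) powr (1 / real k)"
  shows "t_star lam (k + 2) \<rho>0 v0 r = prof_time k (r / a) / (sqrt C / a)"
proof -
  have e: "- (real (k + 2) / 2) * (1 / real k) = - (1 / real k) + - (1 / 2)"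
    using k by (simp add: field_simps)
  have "(A * C powr - (real (k + 2) / 2)) powr (1 / real k)
      = A powr (1 / real k) * (C powr - (real (k + 2) / 2)) powr (1 / real k)"
    by (rule powr_mult)
  also have "(C powr - (real (k + 2) / 2)) powr (1 / real k) = C powr - (1 / real k) * C powr - (1 / 2)"
    by (simp only: powr_powr e powr_add)
  also have "C powr - (1 / real k) = 1 / C powr (1 / real k)" by (rule powr_minus_divide)
  also have "C powr - (1 / 2) = 1 / sqrt C" using C(2) by (simp only: powr_minus_divide powr_half_sqrt)
  also have "A powr (1 / real k) * (1 / C powr (1 / real k) * (1 / sqrt C)) = a / sqrt C"
    using A(2) C(2) by (simp add: a powr_divide)
  finally have scale: "(A * C powr - (real (k + 2) / 2)) powr (1 / real k) = a / sqrt C" .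
  have "(A / C) powr - (1 / real k) = 1 / a" by (simp add: a powr_minus_divide)
  then have bound: "r * (A / C) powr - (1 / real k) = r / a" by simp
  have "real (k + 2) - 2 = real k" by simp
  then show ?thesis
    unfolding t_star_def A(1)[symmetric] C(1)[symmetric]
    using scale bound by (simp add: prof_time_def prof_def)
qed

text \<open>Shifting \<open>spread\<close> by \<open>T'\<close> to get \<open>h\<close> turns the
  outward bound \<open>T'\<close> into \<open>2 * T'\<close> and the inward bound
  \<open>- T'\<close> into 0, and it normalizes \<open>h R\<close> to the reciprocal of the initial
  speed.\<close>

lemma finite_time_breakdown_iff_profile:
  fixes k :: nat and lam :: real and \<rho>0 v0 :: "real \<Rightarrow> real" and X :: "real \<Rightarrow> real \<Rightarrow> real"
  defines "A \<equiv> A_fun lam (k + 2) \<rho>0" and "C \<equiv> C_fun lam (k + 2) \<rho>0 v0"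
  assumes k: "0 < k" and lam: "lam < 0" and R: "0 < R" and v: "v0 R < 0"
    and X: "\<And>r. 0 < r \<Longrightarrow> characteristic_curve lam (k + 2) \<rho>0 v0 r (\<lambda>t. X t r)"
    and dA: "(A has_real_derivative A') (at R)" and dC: "(C has_real_derivative C') (at R)"
    and v_cont: "isCont v0 R" and A_pos: "0 < A R"
  defines "a \<equiv> (A R / C R) powr (1 / real k)"
  obtains h T' where "0 < a" "a ^ k = A R / C R" "a < R" "0 < C R" "h R = 1 / - v0 R"
    "\<And>y. a < y \<Longrightarrow>
      (h has_real_derivative (C' - A' / y ^ k) / (2 * (C R - A R / y ^ k) powr (3 / 2))) (at y)"
    "(t_star lam (k + 2) \<rho>0 v0 has_real_derivative T') (at R)"
    "finite_time_breakdown X R \<longleftrightarrow> A' * C R / A R \<le> C' \<or>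
      (\<exists>y>a. h y \<le> 2 * T') \<or> (\<exists>y>a. y < R \<and> h y \<le> 0)"
proof -
  define as where "as r = (A r / C r) powr (1 / real k)" for r
  define bs where "bs r = sqrt (C r) / as r" for r
  define Ts where "Ts r = prof_time k (r / as r) / bs r" for r
  define b where "b = bs R"
  define a' where "a' = a / real k * (A' / A R - C' / C R)"
  define b' where "b' = C' / (2 * sqrt (C R) * a) - b * a' / a"
  define p where "p = prof k (R / a)"
  define T' where "T' = p * (1 / a - R * a' / a\<^sup>2) / b - b' / b\<^sup>2 * prof_time k (R / a)"
  have A_eq: "A r = A_fun lam (k + 2) \<rho>0 r" and C_eq: "C r = C_fun lam (k + 2) \<rho>0 v0 r" for r
    by (simp_all add: A_def C_def)
  have asR: "as R = a" by (simp add: as_def a_def)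

  have "eventually (\<lambda>r. 0 < A r) (nhds R)"
    using DERIV_isCont[OF dA] A_pos
    by (auto simp: isCont_def tendsto_at_iff_tendsto_nhds intro: order_tendstoD(1))
  moreover have "eventually (\<lambda>r. v0 r < 0) (nhds R)"
    using v_cont v by (auto simp: isCont_def tendsto_at_iff_tendsto_nhds intro: order_tendstoD(2))
  moreover have "eventually (\<lambda>r. 0 < r) (nhds R)"
    using R by (intro eventually_nhds_in_open[of "{0<..}", simplified]) auto
  ultimately have near: "eventually (\<lambda>r. 0 < A r \<and> v0 r < 0 \<and> 0 < r) (nhds R)"
    by eventually_elim simp
  have C_pos: "0 < C r" if "0 < A r" "0 < r" for r
    using that by (simp add: C_def C_fun_def A_def add_nonneg_pos)

  obtain x' where C0: "0 < C R" and a: "0 < a" and b: "0 < b" and aR: "a < R"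
    and T: "0 < Ts R" "X (Ts R) R = a" "x' (Ts R) = 0" and x0: "X 0 R = R" and x'0: "x' 0 = v0 R"
    and cx: "continuous_on {0..} (\<lambda>t. X t R)" "continuous_on {0..} x'"
    and dx: "\<And>t. 0 < t \<Longrightarrow> ((\<lambda>t. X t R) has_real_derivative x' t) (at t)"
    and ge: "\<And>t. 0 \<le> t \<Longrightarrow> a \<le> X t R"
    and law: "\<And>t. 0 \<le> t \<Longrightarrow> prof_time k (X t R / a) = b * \<bar>t - Ts R\<bar>"
    and speed: "\<And>t. 0 \<le> t \<Longrightarrow> t \<noteq> Ts R \<Longrightarrow>
      a < X t R \<and> x' t * prof k (X t R / a) = sgn (t - Ts R) * (a * b)"
    using characteristic_curve_law[OF X[OF R] k lam R v A_eq A_pos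
        C_eq as_def bs_def Ts_def, unfolded asR, folded b_def]
    by blast

  have ak: "a ^ k = A R / C R"
  proof -
    have "a ^ k = a powr real k" using a by (rule powr_realpow [symmetric])
    also have "\<dots> = A R / C R" using A_pos C0 k by (simp add: a_def powr_powr)
    finally show ?thesis .
  qed
  have p: "0 < p" unfolding p_def using a aR by (intro prof_pos[OF k]) simp
  have ab: "a * b = sqrt (C R)" using a by (simp add: b_def bs_def asR)
  \<comment> \<open>The speed relation at time 0, which precedes the turning time.\<close>
  have vp: "v0 R * p = - (a * b)" using speed[of 0] T x0 x'0 by (simp add: p_def)

  have da: "(as has_real_derivative a') (at R)"
    using has_real_derivative_length_scale[OF k dA dC A_pos C0]
    unfolding as_def [abs_def] a'_def a_def .
  have db: "(bs has_real_derivative b') (at R)"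
  proof -
    have "((\<lambda>r. sqrt (C r)) has_real_derivative inverse (sqrt (C R)) / 2 * C') (at R)"
      by (rule DERIV_chain2[OF DERIV_real_sqrt[OF C0] dC])
    from DERIV_divide[OF this da]
    have "(bs has_real_derivative
        (inverse (sqrt (C R)) / 2 * C' * a - sqrt (C R) * a') / (a * a)) (at R)"
      using a unfolding bs_def [abs_def] asR by simp
    moreover have "(inverse (sqrt (C R)) / 2 * C' * a - sqrt (C R) * a') / (a * a) = b'"
      using a b unfolding b'_def ab[symmetric] by (simp add: field_simps)
    ultimately show ?thesis by simp
  qed
  have dT: "(Ts has_real_derivative T') (at R)"
  proof -
    have "((\<lambda>r. r / as r) has_real_derivative (1 * a - R * a') / (a * a)) (at R)"
      using DERIV_divide[OF DERIV_ident da] a unfolding asR by simp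
    then have "((\<lambda>r. prof_time k (r / as r)) has_real_derivative p * ((1 * a - R * a') / (a * a))) (at R)"
      unfolding p_def using prof_time_deriv[OF k, of "R / a"] a aR
      by (intro DERIV_chain2[where f = "prof_time k"]) (simp_all add: asR)
    from DERIV_divide[OF this db]
    have "(Ts has_real_derivative
        (p * ((1 * a - R * a') / (a * a)) * b - prof_time k (R / a) * b') / (b * b)) (at R)"
      using b unfolding Ts_def [abs_def] asR b_def by simp
    moreover have "(p * ((1 * a - R * a') / (a * a)) * b - prof_time k (R / a) * b') / (b * b) = T'"
      using a b by (simp add: T'_def field_simps power2_eq_square)
    ultimately show ?thesis by simp
  qed
  have t_star: "(t_star lam (k + 2) \<rho>0 v0 has_real_derivative T') (at R)"
  proof -
    \<comment> \<open>The two expressions are compared only near \<open>R\<close>, where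
      \<open>A\<close> is positive; this suffices for derivatives.\<close>
    have "eventually (\<lambda>r. Ts r = t_star lam (k + 2) \<rho>0 v0 r) (nhds R)"
      using near
    proof eventually_elim
      case (elim r)
      then show ?case
        using t_star_eq_prof_time[OF k A_eq _ C_eq C_pos as_def]
        by (simp add: Ts_def bs_def)
    qed
    then show ?thesis using dT DERIV_cong_ev[OF refl _ refl] by blast
  qed

  define \<Gamma> where "\<Gamma> t = a' / a * X t R + x' t * (b' / b * (t - Ts R) - T')" for t
  have near_law: "eventually (\<lambda>r. 0 < as r \<and> 0 < bs r \<and>
      (\<forall>t\<ge>0. as r \<le> X t r \<and> prof_time k (X t r / as r) = bs r * \<bar>t - Ts r\<bar>)) (nhds R)"
    using near
  proof eventually_elim
    case (elim r)
    then have "0 < r" "v0 r < 0" "0 < A r" by auto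
    from characteristic_curve_law[OF X[OF this(1)] k lam this(1,2) A_eq this(3)
        C_eq as_def bs_def Ts_def]
    show ?case by metis
  qed
  have flow: "((\<lambda>r. X t r) has_real_derivative \<Gamma> t) (at R)" if "0 < t" for t
    using flow_derivative[OF k near_law da db dT dx[OF that] that]
    by (simp add: \<Gamma>_def asR b_def)
  have pos: "0 < X t R" if "0 \<le> t" for t using ge[OF that] a by simp
  have "finite_time_breakdown X R \<longleftrightarrow> (\<exists>t>0. \<Gamma> t = 0)"
  proof -
    have "in_lifespan (\<lambda>t. X t R) t" "X t R \<noteq> 0" if "0 < t" for t
      using that pos less_imp_neq[OF pos[of t]] by (simp_all add: in_lifespan_def)
    moreover have "(\<lambda>r. X t r) differentiable (at R)" "Gamma X t R = \<Gamma> t" if "0 < t" for t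
      using flow[OF that] unfolding Gamma_def
      by (auto intro: DERIV_imp_deriv simp: real_differentiable_def)
    ultimately show ?thesis unfolding finite_time_breakdown_def by auto
  qed
  also have "\<dots> \<longleftrightarrow> a' \<le> 0 \<or> (\<exists>z>1. spread k a b a' b' z \<le> T') \<or>
      (\<exists>z>1. z < R / a \<and> spread k a b a' b' z \<le> - T')"
    unfolding \<Gamma>_def
  proof (rule breakdown_iff_spread[OF k a b aR T x0 cx ge law speed])
    \<comment> \<open>The flow derivative is available only for positive times, so
      \<open>\<Gamma> 0 = 1\<close> is computed from the formula: the terms with \<open>b'\<close>
      cancel against those in \<open>T'\<close>.\<close>
    have TG: "prof_time k (R / a) = b * Ts R" using law[of 0] x0 T by simp
    have "a' / a * R + v0 R * (b' / b * (0 - Ts R) - T') =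
        a' / a * R - (v0 R * p) * (1 / a - R * a' / a\<^sup>2) / b"
      unfolding T'_def TG using a b by (simp add: field_simps power2_eq_square)
    also have "\<dots> = 1" unfolding vp using a b by (simp add: field_simps power2_eq_square)
    finally show "a' / a * X 0 R + x' 0 * (b' / b * (0 - Ts R) - T') = 1" by (simp add: x0 x'0)
  qed
  finally have breakdown: "finite_time_breakdown X R \<longleftrightarrow> a' \<le> 0 \<or>
      (\<exists>z>1. spread k a b a' b' z \<le> T') \<or> (\<exists>z>1. z < R / a \<and> spread k a b a' b' z \<le> - T')" .

  define h where "h y = spread k a b a' b' (y / a) + T'" for y
  have scale: "(\<exists>z>1. Q z) \<longleftrightarrow> (\<exists>y>a. Q (y / a))" for Q
  proof
    assume "\<exists>z>1. Q z"
    then obtain z where "1 < z" "Q z" by blast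
    then show "\<exists>y>a. Q (y / a)" using a by (intro exI[of _ "a * z"]) simp
  next
    assume "\<exists>y>a. Q (y / a)"
    then obtain y where "a < y" "Q (y / a)" by blast
    then show "\<exists>z>1. Q z" using a by (intro exI[of _ "y / a"]) simp
  qed
  \<comment> \<open>By logarithmic differentiation \<open>a'\<close> has the sign of
    \<open>A' / A - C' / C\<close>; this is the source of condition (5).\<close>
  have a'_iff: "a' \<le> 0 \<longleftrightarrow> A' * C R / A R \<le> C'"
  proof -
    have "0 < a / real k" using a k by simp
    then have "a' \<le> 0 \<longleftrightarrow> A' / A R - C' / C R \<le> 0"
      unfolding a'_def mult_le_0_iff by linarith
    also have "\<dots> \<longleftrightarrow> A' * C R / A R \<le> C'" using A_pos C0 by (simp add: field_simps)
    finally show ?thesis .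
  qed
  have hR: "h R = 1 / - v0 R"
  proof -
    have "h R = p / (a * b)"
      using a b by (simp add: h_def spread_def T'_def flip: p_def) (simp add: field_simps power2_eq_square)
    also have "\<dots> = 1 / - v0 R" using vp p v a b by (simp add: field_simps)
    finally show ?thesis .
  qed
  have dh: "(h has_real_derivative (C' - A' / y ^ k) / (2 * (C R - A R / y ^ k) powr (3 / 2))) (at y)"
    if "a < y" for y
  proof -
    have C_ab: "C R = (a * b)\<^sup>2" using C0 by (simp add: ab)
    have A_ab: "A R = a ^ k * C R" using C0 by (simp add: ak)
    have "a * b' = C' / (2 * sqrt (C R)) - b * a'" using a by (simp add: b'_def field_simps)
    then have "2 * a * b * (a' * b + a * b') = C'"
      unfolding ab[symmetric] using a b by (simp add: field_simps)
    then have C': "C' = 2 * a * b * (a' * b + a * b')" by simp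
    have A': "A' = A R * (real k * a' / a + C' / C R)"
      unfolding a'_def using a k A_pos by (simp add: field_simps)
    show ?thesis
      unfolding h_def [abs_def]
      using DERIV_add[OF spread_deriv[OF k a b C_ab A_ab C' A' that] DERIV_const] by simp
  qed
  have "finite_time_breakdown X R \<longleftrightarrow> A' * C R / A R \<le> C' \<or>
      (\<exists>y>a. h y \<le> 2 * T') \<or> (\<exists>y>a. y < R \<and> h y \<le> 0)"
    unfolding breakdown scale a'_iff using a by (auto simp: h_def divide_less_cancel)
  then show thesis using that[OF a ak aR C0 hR dh t_star] by blast
qed

theorem proposition1p10:
  fixes lam :: real and n :: nat and \<rho>0 v0 :: "real \<Rightarrow> real"
    and X :: "real \<Rightarrow> real \<Rightarrow> real" and R :: real
  assumes "continuous_on {0..} \<rho>0" and "\<And>r. 0 \<le> r \<Longrightarrow> 0 \<le> \<rho>0 r"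
    and "continuous_on {0..} v0" and "v0 C1_differentiable_on {0<..}" and "v0 0 = 0"
    and "lam < 0" and "3 \<le> n"
    and "\<And>r. 0 < r \<Longrightarrow> characteristic_curve lam n \<rho>0 v0 r (\<lambda>t. X t r)"
    and "0 < R" and "v0 R < 0"
  shows "let A = A_fun lam n \<rho>0 R; A' = deriv (A_fun lam n \<rho>0) R;
             C = C_fun lam n \<rho>0 v0 R; C' = deriv (C_fun lam n \<rho>0 v0) R;
             t' = deriv (t_star lam n \<rho>0 v0) R;
             y1 = (A' / C') powr (1 / (real n - 2));
             J = (LBINT y=R..y1. (C' - A' / y ^ (n - 2)) / (C - A / y ^ (n - 2)) powr (3 / 2))
         in finite_time_breakdown X R \<longleftrightarrow>
            A = 0 \<or>
            C' < 0 \<or>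
            (C' = 0 \<and>
              ereal (1 / \<bar>v0 R\<bar>)
                - ereal (1 / 2) * enn2ereal (\<integral>\<^sup>+ y\<in>{R..}.
                    ennreal ((A' / y ^ (n - 2)) / (C - A / y ^ (n - 2)) powr (3 / 2)) \<partial>lborel)
                < ereal (2 * t')) \<or>
            (0 < C' \<and> C' \<le> A' / R ^ (n - 2) \<and>
              1 / \<bar>v0 R\<bar> + 1 / 2 * J \<le> 2 * t') \<or>
            (A' / R ^ (n - 2) < C' \<and> C' < A' * (1 / R ^ (n - 2) + (v0 R)\<^sup>2 / A) \<and>
              1 / \<bar>v0 R\<bar> + 1 / 2 * J \<le> max 0 (2 * t')) \<or>
            A' * (1 / R ^ (n - 2) + (v0 R)\<^sup>2 / A) \<le> C'"
proof -
  define k where "k = n - 2"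
  have k: "0 < k" and n: "n = k + 2" using \<open>3 \<le> n\<close> by (auto simp: k_def)
  have n2: "real n - 2 = real k" "n - 2 = k" by (simp_all add: n)
  define A where "A = A_fun lam n \<rho>0"
  define C where "C = C_fun lam n \<rho>0 v0"
  define A' where "A' = deriv A R"
  define C' where "C' = deriv C R"
  define a where "a = (A R / C R) powr (1 / real k)"
  note R = \<open>0 < R\<close> and v = \<open>v0 R < 0\<close> and X = assms(8)

  obtain v' where dv: "(v0 has_real_derivative v') (at R)"
    using \<open>v0 C1_differentiable_on {0<..}\<close> R
    unfolding C1_differentiable_on_def has_real_derivative_iff_has_vector_derivative by blast
  have "(A has_real_derivative 2 * \<bar>lam\<bar> * (\<rho>0 R * R ^ (n - 1)) / (real n - 2)) (at R)"
    unfolding A_def A_fun_def [abs_def] n2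
    by (intro DERIV_cdivide DERIV_cmult mass0_deriv assms(1) R)
  then have dA: "(A has_real_derivative A') (at R)" and A': "0 \<le> A'"
    using DERIV_imp_deriv assms(2)[of R] R by (force simp: A'_def n2)+
  have "(C has_real_derivative 2 * v0 R * v' + (A' * R ^ k - A R * (real k * R ^ (k - 1))) / (R ^ k * R ^ k)) (at R)"
    unfolding C_def C_fun_def [abs_def] n2 A_def[symmetric]
    using dA R by (auto intro!: derivative_eq_intros dv)
  then have dC: "(C has_real_derivative C') (at R)"
    using DERIV_imp_deriv by (metis C'_def)
  have A0: "0 \<le> A R"
    using mass0_nonneg[OF assms(1,2), of R n] R by (simp add: A_def A_fun_def n2)
  have C_R: "C R = (v0 R)\<^sup>2 + A R / R ^ k" by (simp add: C_def C_fun_def A_def n2)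

  show ?thesis
  proof (cases "A R = 0")
    case True
    \<comment> \<open>Since \<open>lam \<noteq> 0\<close>, vanishing \<open>A\<close> means
      vanishing mass, and the motion is free.\<close>
    then have "mass0 n \<rho>0 R = 0" using \<open>lam < 0\<close> k by (simp add: A_def A_fun_def n2)
    then obtain x' where "X 0 R = R" "x' 0 = v0 R"
      and "\<And>t. in_lifespan (\<lambda>t. X t R) t \<Longrightarrow> 0 < X t R \<Longrightarrow>
        ((\<lambda>t. X t R) has_real_derivative x' t) (at t within {0..})"
      and "\<And>t. in_lifespan (\<lambda>t. X t R) t \<Longrightarrow> 0 < X t R \<Longrightarrow>
        (x' has_real_derivative 0) (at t within {0..})"
      and "\<And>t. in_lifespan (\<lambda>t. X t R) t \<Longrightarrow> continuous (at t within {0..t}) (\<lambda>t. X t R)"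
      using X[OF R] unfolding characteristic_curve_def by auto
    from free_curve_vanishes[where x = "\<lambda>t. X t R", OF R this(1) _ this(3-5)] this(2) v
    have "finite_time_breakdown X R"
      unfolding finite_time_breakdown_def by (intro exI[of _ "R / - v0 R"]) auto
    then show ?thesis using True by (simp add: Let_def A_def)
  next
    case False
    then have A: "0 < A R" using A0 by simp
    obtain h T' where a: "0 < a" "a ^ k = A R / C R" "a < R" and C0: "0 < C R"
      and hR: "h R = 1 / - v0 R"
      and dh: "\<And>y. a < y \<Longrightarrow>
        (h has_real_derivative (C' - A' / y ^ k) / (2 * (C R - A R / y ^ k) powr (3 / 2))) (at y)"
      and t_star: "(t_star lam n \<rho>0 v0 has_real_derivative T') (at R)"
      and breakdown: "finite_time_breakdown X R \<longleftrightarrow> A' * C R / A R \<le> C' \<or>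
        (\<exists>y>a. h y \<le> 2 * T') \<or> (\<exists>y>a. y < R \<and> h y \<le> 0)"
      using finite_time_breakdown_iff_profile[OF k \<open>lam < 0\<close> R v X[unfolded n]
          dA[unfolded A_def n] dC[unfolded C_def n] DERIV_isCont[OF dv] A[unfolded A_def n],
          folded n, folded A_def C_def, folded a_def]
      by blast
    \<comment> \<open>The threshold in conditions (4) and (5) is \<open>A' * C / A\<close>, because
      \<open>C = v0\<^sup>2 + A / R ^ k\<close>.\<close>
    have bound: "A' * (1 / R ^ k + (v0 R)\<^sup>2 / A R) = A' * C R / A R"
      using A R by (simp add: C_R field_simps)
    have T': "deriv (t_star lam n \<rho>0 v0) R = T'" using t_star by (rule DERIV_imp_deriv)
    have v_abs: "\<bar>v0 R\<bar> = - v0 R" using v by simp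
    show ?thesis
    proof (cases "A' * C R / A R \<le> C'")
      case True
      then show ?thesis
        unfolding Let_def n2 A_def[symmetric] C_def[symmetric] A'_def[symmetric] C'_def[symmetric] bound
        using breakdown by blast
    next
      case sub: False
      interpret spread_profile k a R "A R" A' "C R" C' "- v0 R" h
        using k a A C0 A' v hR dh sub by unfold_locales auto
      show ?thesis
        unfolding Let_def n2 A_def[symmetric] C_def[symmetric] A'_def[symmetric] C'_def[symmetric]
          bound T' v_abs breakdown
        using breakdown_cases[of T'] sub False by (meson not_le)
    qed
  qed
qed

end
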